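(* The multi-channel single-index strategy $\Gamma$ described in the context is asymptotically optimal, and its loss satisfies $$L(\theta;\Gamma)\sim O(\ln T).$$
   Context: There are $N$ channels and time slots $j=1,\dots,T$; $B$ is the number of bits that can be sent over a free channel in one slot. The variables $Z_i(j)$ are independent Bernoulli($\theta_i$) ($Z_i(j)=1$ means channel $i$ is free in slot $j$). A single user, not knowing $\theta=(\theta_1,\dots,\theta_N)$, can sense $M\le N$ channels simultaneously: in each slot $j$ it chooses a set $\mathcal M(j)\subseteq\{1,\dots,N\}$ with $|\mathcal M(j)|=M$ based on past observations, observes $Z_i(j)$ for $i\in\mathcal M(j)$, and transmits $\sum_{i\in\mathcal M(j)}BZ_i(j)$ bits. Without loss of generality (for notation only; the user does not know the ordering) $\theta_1\ge\theta_2\ge\cdots\ge\theta_N$. The loss of a strategy $\Gamma$ relative to the case of known $\theta$, in which the $M$ channels with the largest $\theta$'s are sensed, is $$L(\theta;\Gamma)=\sum_{j=1}^T\sum_{i=1}^M B\theta_i-\sum_{j=1}^T B\sum_{i=1}^N\theta_i\Pr\{i\in\mathcal M(j)\}.$$ Asymptotic notation: $g_1(T)=O(g_2(T))$ means that there exist $c_2\ge c_1>0$ and $T_0$ such that $c_1g_2(T)\le g_1(T)\le c_2g_2(T)$ for all $T>T_0$. Asymptotic optimality is meant in the sense of order: a strategy is order optimal if its loss is $\sim O(\ln T)$, $\ln T$ being the order of the lower bound on the loss of any consistent strategy (one such that for any $\theta\in[0,1]^N$ there is $\beta<1$ for which its loss scales as $O(T^\beta)$). Multi-channel single-index strategy.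 The user maintains vectors $\mathbf X,\mathbf Y$, where $X_i$ is the number of time slots in which it has sensed channel $i$ to be free and $Y_i$ is the number of time slots in which it has chosen channel $i$ to sense. (1) Initialization: at the beginning of the block each channel is sensed once; this takes $\lceil N/M\rceil$ slots. (2) After that, at the beginning of slot $j$ it computes $\hat\theta_i(j)=X_i(j)/Y_i(j)$ and the index $$\Lambda_i(j)=\hat\theta_i(j)+\sqrt{\frac{2\ln j}{Y_i(j)}}$$ for each channel $i$, and senses the $M$ channels with the largest $\Lambda_i(j)$. After each sensing, $\mathbf X$ and $\mathbf Y$ are updated.
   Formalization: Two-sided ~O(ln T) is claimed only if θ_N<θ_M (else the loss is 0 or bounded; the upper bound holds for all θ); the lower bound for consistent strategies also needs θ_M<1 (false otherwise); "scales as O(T^β)" in consistency is read as an upper bound only. *)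

theory Defs
  imports "HOL-Probability.Probability" "HOL-Library.Landau_Symbols"
begin

text \<open>
  Channels are \<open>1, \<dots>, N\<close> and slots are \<open>1, 2, \<dots>\<close>. A realization \<open>z\<close> of all the \<open>Z\<^sub>i(j)\<close> is a
  function on pairs (channel, slot); \<open>z (i, j)\<close> means that channel \<open>i\<close> is free in slot \<open>j\<close>.
\<close>

definition params :: "nat \<Rightarrow> (nat \<Rightarrow> real) set" where
  "params N = {\<theta>. \<forall>i\<in>{1..N}. 0 \<le> \<theta> i \<and> \<theta> i \<le> 1}"

definition channel_space :: "nat \<Rightarrow> (nat \<Rightarrow> real) \<Rightarrow> (nat \<times> nat \<Rightarrow> bool) measure" where
  "channel_space N \<theta> = PiM ({1..N} \<times> {1..}) (\<lambda>(i, j). measure_pmf (bernoulli_pmf (\<theta> i)))"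

text \<open>
  A history lists, in chronological order, for each past slot the set of sensed channels together
  with the subset of those that were observed to be free. A strategy maps the history before
  slot \<open>j\<close> (whose length is \<open>j - 1\<close>) to the set of channels sensed in slot \<open>j\<close>.
\<close>

type_synonym history = "(nat set \<times> nat set) list"
type_synonym strategy = "history \<Rightarrow> nat set"

definition is_strategy :: "nat \<Rightarrow> nat \<Rightarrow> strategy \<Rightarrow> bool" where
  "is_strategy N M \<Gamma> \<longleftrightarrow> (\<forall>h. \<Gamma> h \<subseteq> {1..N} \<and> card (\<Gamma> h) = M)"

primrec history_after :: "strategy \<Rightarrow> (nat \<times> nat \<Rightarrow> bool) \<Rightarrow> nat \<Rightarrow> history" where
  "history_after \<Gamma> z 0 = []"
| "history_after \<Gamma> z (Suc j) =
     (let h = history_after \<Gamma> z j in h @ [(\<Gamma> h, {i \<in> \<Gamma> h. z (i, Suc j)})])"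

definition sensed :: "strategy \<Rightarrow> (nat \<times> nat \<Rightarrow> bool) \<Rightarrow> nat \<Rightarrow> nat set" where
  "sensed \<Gamma> z j = \<Gamma> (history_after \<Gamma> z (j - 1))"

text \<open>
  The \<open>i\<close>-th largest of \<open>\<theta>\<^sub>1, \<dots>, \<theta>\<^sub>N\<close> (counting multiplicities, \<open>1 \<le> i \<le> N\<close>). With it the loss can be
  written for a parameter vector in arbitrary order. Consistency has to range over all of
  \<open>[0,1]\<^sup>N\<close> and not only over the non-increasing vectors, since the user does not know the ordering.
\<close>

definition ranked :: "nat \<Rightarrow> (nat \<Rightarrow> real) \<Rightarrow> nat \<Rightarrow> real" where
  "ranked N \<theta> i = rev (sort (map \<theta> [1..<Suc N])) ! (i - 1)"

lemma ranked_eq_self: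
  assumes dec: "\<And>i k. 1 \<le> i \<Longrightarrow> i \<le> k \<Longrightarrow> k \<le> N \<Longrightarrow> \<theta> k \<le> \<theta> i" and i: "i \<in> {1..N}"
  shows "ranked N \<theta> i = \<theta> i"
proof -
  let ?xs = "map \<theta> [1..<Suc N]"
  have "sorted (rev ?xs)"
    unfolding sorted_iff_nth_mono
  proof (intro allI impI)
    fix a b assume ab: "a \<le> b" "b < length (rev ?xs)"
    then have b: "b < N" by (simp del: upt_Suc)
    have "rev ?xs ! a = \<theta> (N - a)" "rev ?xs ! b = \<theta> (N - b)"
      using ab b by (auto simp: rev_nth Suc_diff_Suc simp del: upt_Suc)
    then show "rev ?xs ! a \<le> rev ?xs ! b"
      using dec[of "N - b" "N - a"] ab b by auto
  qed
  then have "sort ?xs = rev ?xs"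
    by (intro properties_for_sort) auto
  then show ?thesis
    using i by (auto simp: ranked_def less_Suc_eq_le simp del: upt_Suc)
qed

definition loss :: "nat \<Rightarrow> nat \<Rightarrow> real \<Rightarrow> (nat \<Rightarrow> real) \<Rightarrow> strategy \<Rightarrow> nat \<Rightarrow> real" where
  "loss N M B \<theta> \<Gamma> T =
     (\<Sum>j=1..T. \<Sum>i=1..M. B * ranked N \<theta> i)
     - (\<Sum>j=1..T. B * (\<Sum>i=1..N. \<theta> i *
          measure (channel_space N \<theta>) {z \<in> space (channel_space N \<theta>). i \<in> sensed \<Gamma> z j}))"

text \<open>The two-sided order relation; a one-sided bound is written with the library's \<^const>\<open>bigo\<close>.\<close>

definition same_order :: "(nat \<Rightarrow> real) \<Rightarrow> (nat \<Rightarrow> real) \<Rightarrow> bool" where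
  "same_order g1 g2 \<longleftrightarrow>
     (\<exists>c1 c2 T0. 0 < c1 \<and> c1 \<le> c2 \<and> (\<forall>T>T0. c1 * g2 T \<le> g1 T \<and> g1 T \<le> c2 * g2 T))"

text \<open>
  Here the one-sided reading is needed: a loss of order \<open>ln T\<close> is not of exact order \<open>T powr \<beta>\<close>
  for any \<open>\<beta>\<close>, and for a constant \<open>\<theta>\<close> every loss is 0.
\<close>

definition consistent :: "nat \<Rightarrow> nat \<Rightarrow> real \<Rightarrow> strategy \<Rightarrow> bool" where
  "consistent N M B \<Gamma> \<longleftrightarrow> is_strategy N M \<Gamma> \<and>
     (\<forall>\<theta>\<in>params N. \<exists>\<beta><1. loss N M B \<theta> \<Gamma> \<in> O(\<lambda>T. real T powr \<beta>))"

text \<open>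
  A loss of exact order \<open>ln T\<close> needs some channel strictly worse than the \<open>M\<close>-th best one. If
  \<open>\<theta>\<^sub>1 = \<dots> = \<theta>\<^sub>N\<close>, or \<open>M = N\<close>, every strategy has loss 0; if \<open>\<theta>\<^sub>1 > \<theta>\<^sub>M = \<theta>\<^sub>N\<close>, the channels tied for
  the \<open>M\<close>-th place are sampled linearly often anyway and the loss can stay bounded.
\<close>

definition nondegenerate :: "nat \<Rightarrow> nat \<Rightarrow> (nat \<Rightarrow> real) \<Rightarrow> bool" where
  "nondegenerate N M \<theta> \<longleftrightarrow> ranked N \<theta> N < ranked N \<theta> M"

text \<open>
  Order optimality: among the consistent strategies, loss of exact order \<open>ln T\<close>, which is the order
  of the lower bound for every consistent strategy. The lower bound needs room
  above the \<open>M\<close>-th best channel: if \<open>\<theta>\<^sub>M = 1\<close>, no parameter can make a bad channel better than it.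
\<close>

definition order_optimal :: "nat \<Rightarrow> nat \<Rightarrow> real \<Rightarrow> strategy \<Rightarrow> bool" where
  "order_optimal N M B \<Gamma> \<longleftrightarrow>
     consistent N M B \<Gamma> \<and>
     (\<forall>\<theta>\<in>params N. nondegenerate N M \<theta> \<longrightarrow> same_order (loss N M B \<theta> \<Gamma>) (\<lambda>T. ln (real T))) \<and>
     (\<forall>\<Gamma>'. consistent N M B \<Gamma>' \<longrightarrow>
        (\<forall>\<theta>\<in>params N. nondegenerate N M \<theta> \<and> ranked N \<theta> M < 1 \<longrightarrow>
           loss N M B \<theta> \<Gamma>' \<in> \<Omega>(\<lambda>T. ln (real T))))"

definition sensed_free_count :: "history \<Rightarrow> nat \<Rightarrow> nat" where
  "sensed_free_count h i = length (filter (\<lambda>(S, F). i \<in> F) h)"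

definition sensed_count :: "history \<Rightarrow> nat \<Rightarrow> nat" where
  "sensed_count h i = length (filter (\<lambda>(S, F). i \<in> S) h)"

definition index :: "history \<Rightarrow> nat \<Rightarrow> real" where
  "index h i = real (sensed_free_count h i) / real (sensed_count h i)
     + sqrt (2 * ln (real (length h + 1)) / real (sensed_count h i))"

definition init_slots :: "nat \<Rightarrow> nat \<Rightarrow> nat" where
  "init_slots N M = nat \<lceil>real N / real M\<rceil>"

text \<open>
  A predicate rather than one function, because the order of sensing in the initialization and the
  choice between equal indices are left open. If \<open>M\<close> divides \<open>N\<close>, the initialization condition
  forces every channel to be sensed exactly once; otherwise \<open>M \<lceil>N/M\<rceil> > N\<close>, and the surplus sensings
  may go to any channels.
\<close>

definition single_index_strategy :: "nat \<Rightarrow> nat \<Rightarrow> strategy \<Rightarrow> bool" where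
  "single_index_strategy N M \<Gamma> \<longleftrightarrow> is_strategy N M \<Gamma> \<and>
     (\<forall>z. (\<Union>j\<in>{1..init_slots N M}. sensed \<Gamma> z j) = {1..N} \<and>
          (\<forall>j>init_slots N M. \<forall>i\<in>sensed \<Gamma> z j. \<forall>k\<in>{1..N} - sensed \<Gamma> z j.
             index (history_after \<Gamma> z (j - 1)) k \<le> index (history_after \<Gamma> z (j - 1)) i))"

end

theory Submission
  imports Defs "HOL-Real_Asymp.Real_Asymp"
begin

text \<open>
  The probabilistic bounds change the measure in one channel parameter on the finite set of histories of
  length \<open>T\<close>, whose probabilities are explicit products. Tilting the parameter of a channel gives the
  Chernoff bound \<open>2 * exp (- 2 * a\<^sup>2 / s)\<close> for the deviation after \<open>s\<close> adaptive sensings; with the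
  padding term of the index it shows that a worse channel is preferred to a better one
  \<open>O(ln T)\<close> times in expectation. Raising the parameter of a worst channel above the \<open>M\<close>-th best
  one shows that a consistent strategy must sense it of the order \<open>ln T\<close> times. When the \<open>M\<close>-th
  best parameter is 1, there is no room for this; the matching lower bound for the index strategy
  comes instead from its padding term, which forces \<open>ln T / 4\<close> sensings of every channel
  on every sample path.
\<close>

section \<open>Regret of a set of channels\<close>

text \<open>With \<open>M\<close> channels per slot the loss is controlled by counting swaps, that
  is, slots in which a worse channel is sensed while a better one is left out: a slot with positive
  regret contains a swap and costs at most \<open>M\<close>, and a swap is a comparison of just two
  indices. The number of sensings behind an estimate is random and depends on earlier outcomes, so a
  deviation bound is needed for every possible value of it. The padding
  \<open>sqrt (2 * ln j / Y)\<close> makes each such bound of order \<open>1 / j ^ 4\<close>, and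
  the union over fewer than \<open>j\<close> values is still summable in \<open>j\<close>. All
  quantities up to slot \<open>T\<close> are functions of the history, which takes only finitely
  many values. Measurability and integrability follow from this, and a change of parameter becomes a
  termwise comparison of two finite sums.\<close>

lemma ranked_eq_nth:
  fixes N :: nat and \<theta> :: "nat \<Rightarrow> real"
  defines "l \<equiv> rev (sort_key \<theta> [1..<Suc N])"
  assumes "i \<in> {1..N}"
  shows "ranked N \<theta> i = \<theta> (l ! (i - 1))"
proof -
  have "map \<theta> (sort_key \<theta> [1..<Suc N]) = sort (map \<theta> [1..<Suc N])"
    by (intro properties_for_sort[symmetric]) (simp_all del: upt_Suc)
  then have "rev (sort (map \<theta> [1..<Suc N])) = map \<theta> l"
    unfolding l_def rev_map[symmetric] by (rule arg_cong[where f = rev, OF sym])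
  moreover have "length l = N"
    by (simp add: l_def)
  ultimately show ?thesis
    using assms(2) unfolding ranked_def by auto
qed

text \<open>\<open>ranked\<close> only knows sorted values. A concrete set \<open>G\<close> of
  \<open>M\<close> channels attaining the benchmark makes exchange arguments possible; with ties it
  is one of several choices, and the last three facts relate it to the threshold value
  alone.\<close>

lemma ranked_top_set:
  fixes N M :: nat and \<theta> :: "nat \<Rightarrow> real"
  assumes M: "1 \<le> M" "M \<le> N"
  obtains G where "G \<subseteq> {1..N}" "card G = M" "(\<Sum>i=1..M. ranked N \<theta> i) = (\<Sum>i\<in>G. \<theta> i)"
    "\<And>i. i \<in> G \<Longrightarrow> ranked N \<theta> M \<le> \<theta> i" "\<And>k. k \<in> {1..N} - G \<Longrightarrow> \<theta> k \<le> ranked N \<theta> M"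
    "\<exists>i\<in>G. \<theta> i = ranked N \<theta> M"
proof -
  define l where "l = rev (sort_key \<theta> [1..<Suc N])"
  have len: "length l = N" and dl: "distinct l" and sl: "set l = {1..N}"
    by (auto simp: l_def simp del: upt_Suc)
  have r: "ranked N \<theta> i = \<theta> (l ! (i - 1))" if "i \<in> {1..N}" for i
    using ranked_eq_nth[OF that, of \<theta>] by (simp add: l_def)
  have srt: "\<theta> (l ! b) \<le> \<theta> (l ! a)" if "a \<le> b" "b < N" for a b
  proof -
    have "sorted (map \<theta> (rev l))"
      by (simp add: l_def del: upt_Suc)
    then have "sorted_wrt (\<ge>) (map \<theta> l)"
      unfolding rev_map[symmetric] sorted_wrt_rev .
    then show ?thesis
      using that len by (cases "a = b") (auto simp: sorted_wrt_iff_nth_less)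
  qed
  define G where "G = set (take M l)"
  have G: "G = (\<lambda>a. l ! a) ` {..<M}"
    using M len nth_image[of M l] by (simp only: G_def lessThan_atLeast0)
  have nG: "\<exists>a. M \<le> a \<and> a < N \<and> k = l ! a" if "k \<in> {1..N} - G" for k
  proof -
    have "k \<in> set l"
      using that sl by blast
    then obtain a where "a < N" "k = l ! a"
      unfolding in_set_conv_nth len by blast
    moreover from this that have "\<not> a < M"
      by (auto simp: G)
    ultimately show ?thesis
      by (intro exI[of _ a]) simp
  qed
  have inj: "inj_on (\<lambda>a. l ! a) {..<M}"
    using dl M len by (auto simp: inj_on_def nth_eq_iff_index_eq)
  have "(\<Sum>i=1..M. ranked N \<theta> i) = (\<Sum>i=1..M. \<theta> (l ! (i - 1)))"
    using r M by (intro sum.cong) auto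
  also have "\<dots> = (\<Sum>a<M. \<theta> (l ! a))"
    by (rule sum.reindex_bij_witness[of _ Suc "\<lambda>i. i - 1"]) auto
  also have "\<dots> = (\<Sum>i\<in>G. \<theta> i)"
    using inj by (simp add: G sum.reindex)
  finally have 1: "(\<Sum>i=1..M. ranked N \<theta> i) = (\<Sum>i\<in>G. \<theta> i)" .
  show ?thesis
  proof (rule that[OF _ _ 1])
    show "G \<subseteq> {1..N}"
      using sl by (auto simp: G_def dest: in_set_takeD)
    show "card G = M"
      using inj by (simp add: G card_image)
    show "ranked N \<theta> M \<le> \<theta> i" if "i \<in> G" for i
      using that M r[of M] srt[of _ "M - 1"] by (auto simp: G)
    show "\<theta> k \<le> ranked N \<theta> M" if "k \<in> {1..N} - G" for k
      using nG[OF that] M r[of M] srt[of "M - 1"] by auto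
    show "\<exists>i\<in>G. \<theta> i = ranked N \<theta> M"
      using M r[of M] by (auto simp: G)
  qed
qed

lemma ranked_last_attained:
  assumes "1 \<le> N"
  obtains k where "k \<in> {1..N}" "\<theta> k = ranked N \<theta> N"
  using ranked_top_set[of N N \<theta>] assms by (metis le_refl subset_iff)

definition slot_regret :: "nat \<Rightarrow> nat \<Rightarrow> (nat \<Rightarrow> real) \<Rightarrow> nat set \<Rightarrow> real" where
  "slot_regret N M \<theta> S = (\<Sum>i=1..M. ranked N \<theta> i) - (\<Sum>i\<in>S. \<theta> i)"

lemma card_Diff_eq:
  assumes "finite A" "finite B" "card A = card B"
  shows "card (A - B) = card (B - A)"
  using assms by (metis Int_commute card_Diff_subset_Int finite_Int)

text \<open>\<open>S\<close> and the top set \<open>G\<close> both have \<open>M\<close> elements,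
  so the \<open>M\<close>-th best value may be subtracted from every summand. What remains is the
  surplus of the channels of \<open>G\<close> left out plus the deficit of the channels sensed
  outside \<open>G\<close>, and all these terms are nonnegative.\<close>

lemma slot_regret_ge:
  assumes M: "1 \<le> M" "M \<le> N" and S: "S \<subseteq> {1..N}" "card S = M"
  shows slot_regret_nonneg: "0 \<le> slot_regret N M \<theta> S"
    and slot_regret_ge_gap: "k \<in> S \<Longrightarrow> ranked N \<theta> M - \<theta> k \<le> slot_regret N M \<theta> S"
proof -
  obtain G where G: "G \<subseteq> {1..N}" "card G = M" "(\<Sum>i=1..M. ranked N \<theta> i) = (\<Sum>i\<in>G. \<theta> i)"
    "\<And>i. i \<in> G \<Longrightarrow> ranked N \<theta> M \<le> \<theta> i" "\<And>k. k \<in> {1..N} - G \<Longrightarrow> \<theta> k \<le> ranked N \<theta> M"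
    using ranked_top_set[OF M, of \<theta>] by metis
  let ?v = "ranked N \<theta> M"
  have fin: "finite G" "finite S"
    using G S finite_subset by blast+
  have "slot_regret N M \<theta> S = (\<Sum>i\<in>G. \<theta> i - ?v) - (\<Sum>i\<in>S. \<theta> i - ?v)"
    using G(2) S(2) unfolding slot_regret_def G(3) by (simp add: sum_subtractf)
  also have "\<dots> = (\<Sum>i\<in>G - S. \<theta> i - ?v) + (\<Sum>i\<in>S - G. ?v - \<theta> i)"
  proof -
    have "(\<Sum>i\<in>G. \<theta> i - ?v) = (\<Sum>i\<in>G - S. \<theta> i - ?v) + (\<Sum>i\<in>G \<inter> S. \<theta> i - ?v)"
      using fin by (subst add.commute, subst sum.Int_Diff[of G _ S]) auto
    moreover have "(\<Sum>i\<in>S. \<theta> i - ?v) = (\<Sum>i\<in>S - G. \<theta> i - ?v) + (\<Sum>i\<in>G \<inter> S. \<theta> i - ?v)"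
      using fin by (subst add.commute, subst sum.Int_Diff[of S _ G]) (auto simp: Int_commute)
    ultimately show ?thesis
      by (simp add: sum_subtractf)
  qed
  finally have eq: "slot_regret N M \<theta> S = \<dots>" .
  have g: "0 \<le> (\<Sum>i\<in>G - S. \<theta> i - ?v)"
    using G(4) by (intro sum_nonneg) auto
  have s: "0 \<le> ?v - \<theta> i" if "i \<in> S - G" for i
    using G(5) S that by auto
  have s': "0 \<le> (\<Sum>i\<in>S - G. ?v - \<theta> i)"
    using s by (rule sum_nonneg)
  show nonneg: "0 \<le> slot_regret N M \<theta> S"
    using eq g s' by simp
  show "ranked N \<theta> M - \<theta> k \<le> slot_regret N M \<theta> S" if "k \<in> S"
  proof (cases "k \<in> G")
    case True
    then show ?thesis
      using G(4) nonneg by fastforce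
  next
    case False
    then have "?v - \<theta> k \<le> (\<Sum>i\<in>S - G. ?v - \<theta> i)"
      using that fin s by (intro member_le_sum[where f="\<lambda>i. ?v - \<theta> i"]) auto
    then show ?thesis
      using eq g by simp
  qed
qed

text \<open>Otherwise a bijection from \<open>G - S\<close> to \<open>S - G\<close> would never
  decrease the parameter, and \<open>S\<close> would be as good as the top set
  \<open>G\<close>.\<close>

lemma slot_regret_pos_swap:
  assumes M: "1 \<le> M" "M \<le> N" and S: "S \<subseteq> {1..N}" "card S = M"
    and pos: "0 < slot_regret N M \<theta> S"
  obtains i k where "i \<in> S" "k \<in> {1..N} - S" "\<theta> i < \<theta> k"
proof -
  obtain G where G: "G \<subseteq> {1..N}" "card G = M" "(\<Sum>i=1..M. ranked N \<theta> i) = (\<Sum>i\<in>G. \<theta> i)"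
    using ranked_top_set[OF M, of \<theta>] by metis
  have fin: "finite G" "finite S"
    using G S finite_subset by blast+
  have card: "card (G - S) = card (S - G)"
    using card_Diff_eq[OF fin] G S by simp
  have "\<exists>i\<in>S. \<exists>k\<in>{1..N} - S. \<theta> i < \<theta> k"
  proof (rule ccontr)
    assume "\<not> ?thesis"
    then have le: "\<theta> k \<le> \<theta> i" if "i \<in> S" "k \<in> {1..N} - S" for i k
      using that by force
    obtain f where f: "bij_betw f (G - S) (S - G)"
      using finite_same_card_bij[of "G - S" "S - G"] fin card by auto
    have "(\<Sum>k\<in>G - S. \<theta> k) \<le> (\<Sum>k\<in>G - S. \<theta> (f k))"
      using f G le by (intro sum_mono le) (auto simp: bij_betw_def)
    also have "\<dots> = (\<Sum>i\<in>S - G. \<theta> i)"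
      using f by (rule sum.reindex_bij_betw)
    finally have "(\<Sum>i\<in>G. \<theta> i) \<le> (\<Sum>i\<in>S. \<theta> i)"
      using fin by (metis (no_types) Int_commute add_left_mono sum.Int_Diff)
    with pos G show False
      by (simp add: slot_regret_def)
  qed
  with that show ?thesis
    by blast
qed

lemma slot_regret_le:
  assumes M: "1 \<le> M" "M \<le> N" and S: "S \<subseteq> {1..N}" "card S = M" and \<theta>: "\<theta> \<in> params N"
  shows "slot_regret N M \<theta> S \<le> M"
proof -
  obtain G where G: "G \<subseteq> {1..N}" "card G = M" "(\<Sum>i=1..M. ranked N \<theta> i) = (\<Sum>i\<in>G. \<theta> i)"
    using ranked_top_set[OF M, of \<theta>] by metis
  have "(\<Sum>i\<in>G. \<theta> i) \<le> (\<Sum>i\<in>G. 1)"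
    using \<theta> G by (intro sum_mono) (auto simp: params_def)
  moreover have "0 \<le> (\<Sum>i\<in>S. \<theta> i)"
    using \<theta> S by (intro sum_nonneg) (auto simp: params_def)
  ultimately show ?thesis
    using G by (simp add: slot_regret_def)
qed

text \<open>Among any \<open>M\<close> channels some \<open>i\<close> is no better than the
  \<open>M\<close>-th best. Exchanging it for \<open>k\<close> gains at least
  \<open>q - ranked N \<theta> M\<close>, and no set beats the benchmark of the raised vector, so
  that benchmark need not be computed.\<close>

lemma slot_regret_raised_channel:
  assumes M: "1 \<le> M" "M \<le> N" and S: "S \<subseteq> {1..N}" "card S = M" and k: "k \<in> {1..N} - S"
  shows "q - ranked N \<theta> M \<le> slot_regret N M (\<theta>(k := q)) S"
proof -
  obtain G where G: "G \<subseteq> {1..N}" "card G = M"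
    "\<And>k. k \<in> {1..N} - G \<Longrightarrow> \<theta> k \<le> ranked N \<theta> M"
    "\<exists>i\<in>G. \<theta> i = ranked N \<theta> M"
    using ranked_top_set[OF M, of \<theta>] by metis
  have fin: "finite G" "finite S"
    using G S finite_subset by blast+
  obtain i where i: "i \<in> S" "\<theta> i \<le> ranked N \<theta> M"
  proof (cases "S = G")
    case False
    then have "\<not> S \<subseteq> G"
      using fin G S by (metis card_subset_eq)
    with G S that show ?thesis
      by blast
  qed (use G that in auto)
  let ?S' = "insert k (S - {i})"
  have S': "?S' \<subseteq> {1..N}" "card ?S' = M"
    using k S i fin M by (auto simp: card_insert_if)
  have "sum (\<theta>(k := q)) ?S' = q + sum \<theta> (S - {i})"
    using k fin by (subst sum.insert) (auto intro!: sum.cong split: if_splits)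
  moreover have "sum (\<theta>(k := q)) S = \<theta> i + sum \<theta> (S - {i})"
  proof -
    have "sum (\<theta>(k := q)) S = sum \<theta> S"
      using k by (intro sum.cong) auto
    then show ?thesis
      using sum.remove[of S i \<theta>] fin i by simp
  qed
  ultimately show ?thesis
    using slot_regret_nonneg[OF M S', of "\<theta>(k := q)"] i
    unfolding slot_regret_def by linarith
qed

section \<open>Likelihood of a history\<close>

lemma length_history_after [simp]: "length (history_after \<Gamma> z T) = T"
  by (induction T) (auto simp: Let_def)

lemma sensed_Suc: "sensed \<Gamma> z (Suc T) = \<Gamma> (history_after \<Gamma> z T)"
  by (simp add: sensed_def)

lemma history_after_Suc_sensed:
  "history_after \<Gamma> z (Suc T) =
     history_after \<Gamma> z T @ [(sensed \<Gamma> z (Suc T), {i \<in> sensed \<Gamma> z (Suc T). z (i, Suc T)})]"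
  by (simp add: Let_def sensed_Suc)

lemma sensed_count_0 [simp]: "sensed_count (history_after \<Gamma> z 0) i = 0"
  by (simp add: sensed_count_def)

lemma sensed_free_count_0 [simp]: "sensed_free_count (history_after \<Gamma> z 0) i = 0"
  by (simp add: sensed_free_count_def)

lemma sensed_count_Suc:
  "sensed_count (history_after \<Gamma> z (Suc T)) i =
     sensed_count (history_after \<Gamma> z T) i + of_bool (i \<in> sensed \<Gamma> z (Suc T))"
  unfolding history_after_Suc_sensed by (simp add: sensed_count_def)

lemma sensed_free_count_Suc:
  "sensed_free_count (history_after \<Gamma> z (Suc T)) i =
     sensed_free_count (history_after \<Gamma> z T) i +
       of_bool (i \<in> sensed \<Gamma> z (Suc T) \<and> z (i, Suc T))"
  unfolding history_after_Suc_sensed by (simp add: sensed_free_count_def)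

lemma sensed_free_count_le:
  "sensed_free_count (history_after \<Gamma> z T) i \<le> sensed_count (history_after \<Gamma> z T) i"
  by (induction T) (auto simp: sensed_count_Suc sensed_free_count_Suc simp del: history_after.simps)

lemma sensed_count_eq_sum:
  "sensed_count (history_after \<Gamma> z T) i = (\<Sum>j=1..T. of_bool (i \<in> sensed \<Gamma> z j))"
  by (induction T) (auto simp: sensed_count_Suc simp del: history_after.simps)

lemma sensed_count_eq_card:
  "sensed_count (history_after \<Gamma> z T) i = card {j \<in> {1..T}. i \<in> sensed \<Gamma> z j}"
  by (simp add: sensed_count_eq_sum Int_def flip: sum.inter_filter)

lemma sensed_count_le: "sensed_count (history_after \<Gamma> z T) i \<le> T"
  by (induction T) (auto simp: sensed_count_Suc simp del: history_after.simps)

lemma sensed_count_mono: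
  "S \<le> T \<Longrightarrow> sensed_count (history_after \<Gamma> z S) i \<le> sensed_count (history_after \<Gamma> z T) i"
  by (induction T rule: dec_induct) (auto simp: sensed_count_Suc simp del: history_after.simps)

text \<open>Only sensed coordinates enter a history, so a fixed history is a cylinder event over
  finitely many pairs, all determined by the reference realization \<open>w\<close>.\<close>

lemma history_after_eq_iff:
  "history_after \<Gamma> z T = history_after \<Gamma> w T \<longleftrightarrow>
     (\<forall>j\<in>{1..T}. \<forall>i\<in>sensed \<Gamma> w j. z (i, j) = w (i, j))"
proof (induction T)
  case (Suc T)
  have "history_after \<Gamma> z (Suc T) = history_after \<Gamma> w (Suc T) \<longleftrightarrow>
      history_after \<Gamma> z T = history_after \<Gamma> w T \<and>
      (\<forall>i\<in>sensed \<Gamma> w (Suc T). z (i, Suc T) = w (i, Suc T))"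
    by (auto simp: Let_def sensed_Suc)
  then show ?case
    unfolding Suc.IH by (auto simp: atLeastAtMostSuc_conv)
qed simp

text \<open>There is no factor for the choice of \<open>S\<close>, since a strategy determines it
  from the preceding history.\<close>

definition likelihood :: "(nat \<Rightarrow> real) \<Rightarrow> history \<Rightarrow> real" where
  "likelihood \<theta> h = prod_list (map (\<lambda>(S, F). \<Prod>i\<in>S. if i \<in> F then \<theta> i else 1 - \<theta> i) h)"

lemma likelihood_Suc:
  "likelihood \<theta> (history_after \<Gamma> z (Suc T)) =
     likelihood \<theta> (history_after \<Gamma> z T) *
       (\<Prod>i\<in>sensed \<Gamma> z (Suc T). if z (i, Suc T) then \<theta> i else 1 - \<theta> i)"
  unfolding history_after_Suc_sensed by (simp add: likelihood_def cong: prod.cong)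

lemma likelihood_eq_prod:
  "likelihood \<theta> (history_after \<Gamma> z T) =
     (\<Prod>j=1..T. \<Prod>i\<in>sensed \<Gamma> z j. if z (i, j) then \<theta> i else 1 - \<theta> i)"
  by (induction T) (simp_all add: likelihood_def[of _ "[]"] likelihood_Suc del: history_after.simps(2))

text \<open>Hoeffding's lemma for a centred Bernoulli variable; negative \<open>l\<close> are
  reduced to positive ones by exchanging the roles of free and busy.\<close>

lemma bernoulli_mgf_le:
  fixes p l :: real
  assumes "0 \<le> p" "p \<le> 1"
  shows "p * exp (l * (1 - p)) + (1 - p) * exp (- l * p) \<le> exp (l\<^sup>2 / 8)"
proof -
  have *: "p * exp (l * (1 - p)) + (1 - p) * exp (- l * p) \<le> exp (l\<^sup>2 / 8)"
    if "0 \<le> p" "p \<le> 1" "0 \<le> l" for p l :: real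
  proof -
    have pos: "0 < 1 + p * (exp l - 1)"
      using that by (simp add: add_pos_nonneg)
    have "p * exp (l * (1 - p)) + (1 - p) * exp (- l * p) = exp (- l * p) * (1 + p * (exp l - 1))"
      by (simp add: algebra_simps flip: exp_add)
    also have "\<dots> = exp (- l * p + ln (1 + p * (exp l - 1)))"
      by (simp only: exp_add exp_ln[OF pos])
    also have "\<dots> \<le> exp (l\<^sup>2 / 8)"
      using Hoeffdings_lemma_aux[of l p] that by simp
    finally show ?thesis .
  qed
  show ?thesis
  proof (cases "0 \<le> l")
    case False
    then show ?thesis
      using *[of "1 - p" "- l"] assms by (simp add: algebra_simps)
  qed (use * assms in auto)
qed

text \<open>The change of measure has to serve both the index strategy and every consistent
  competitor, hence a locale for arbitrary strategies.\<close>

locale channel_strategy =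
  fixes N M :: nat and \<Gamma> :: strategy
  assumes is_strategy: "is_strategy N M \<Gamma>"
begin

lemma sensed_subset: "sensed \<Gamma> z j \<subseteq> {1..N}"
  using is_strategy by (simp add: is_strategy_def sensed_def)

lemma card_sensed: "card (sensed \<Gamma> z j) = M"
  using is_strategy by (simp add: is_strategy_def sensed_def)

lemma finite_sensed: "finite (sensed \<Gamma> z j)"
  using sensed_subset finite_subset by blast

lemma sum_not_sensed:
  "(\<Sum>j=1..T. of_bool (k \<notin> sensed \<Gamma> z j) :: real)
    = real T - real (sensed_count (history_after \<Gamma> z T) k)"
  by (simp add: sensed_count_eq_sum of_bool_not_iff sum_subtractf)

lemma finite_histories: "finite (range (\<lambda>z. history_after \<Gamma> z T))"
proof (rule finite_subset)
  let ?A = "Pow {1..N} \<times> Pow {1..N}"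
  show "range (\<lambda>z. history_after \<Gamma> z T) \<subseteq> {h. set h \<subseteq> ?A \<and> length h = T}"
  proof safe
    fix z S F assume "(S, F) \<in> set (history_after \<Gamma> z T)"
    then have "S \<in> Pow {1..N} \<and> F \<in> Pow {1..N}"
    proof (induction T)
      case (Suc T)
      then show ?case
        unfolding history_after_Suc_sensed using sensed_subset[of z "Suc T"] by auto
    qed simp
    then show "\<And>x. x \<in> S \<Longrightarrow> x \<in> {1..N}" "\<And>x. x \<in> F \<Longrightarrow> x \<in> {1..N}"
      by auto
  qed simp
  show "finite {h. set h \<subseteq> ?A \<and> length h = T}"
    by (intro finite_lists_length_eq) auto
qed

lemma likelihood_nonneg: "\<theta> \<in> params N \<Longrightarrow> 0 \<le> likelihood \<theta> (history_after \<Gamma> z T)"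
  unfolding likelihood_eq_prod using sensed_subset
  by (intro prod_nonneg) (fastforce simp: params_def)

text \<open>\<open>a\<close> and \<open>b\<close> bound the likelihood ratio of one free and one
  busy observation of channel \<open>k\<close>; all other factors agree. Stating their conditions as
  products avoids division by \<open>q\<close> or \<open>1 - q\<close>, which may be 0.\<close>

lemma likelihood_change_channel:
  fixes \<theta> :: "nat \<Rightarrow> real"
  assumes \<theta>: "\<theta> \<in> params N" and q: "0 \<le> q" "q \<le> 1" and ab: "0 \<le> a" "0 \<le> b"
    and le: "\<theta> k \<le> a * q" "1 - \<theta> k \<le> b * (1 - q)"
  shows "likelihood \<theta> (history_after \<Gamma> z T) \<le>
    a ^ sensed_free_count (history_after \<Gamma> z T) k *
    b ^ (sensed_count (history_after \<Gamma> z T) k - sensed_free_count (history_after \<Gamma> z T) k) *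
    likelihood (\<theta>(k := q)) (history_after \<Gamma> z T)"
proof (induction T)
  case 0
  then show ?case
    by (simp add: likelihood_def sensed_count_def sensed_free_count_def)
next
  case (Suc T)
  let ?X = "sensed_free_count (history_after \<Gamma> z T) k"
  let ?Y = "sensed_count (history_after \<Gamma> z T) k"
  let ?L = "\<lambda>\<theta>. likelihood \<theta> (history_after \<Gamma> z T)"
  define S where "S = sensed \<Gamma> z (Suc T)"
  define f where "f \<theta> i = (if z (i, Suc T) then \<theta> i else 1 - \<theta> i)" for \<theta> :: "nat \<Rightarrow> real" and i
  define c where "c = (if k \<in> S then if z (k, Suc T) then a else b else 1)"
  have fin: "finite S" and sub: "S \<subseteq> {1..N}"
    using finite_sensed sensed_subset by (auto simp: S_def)
  have \<theta>': "\<theta>(k := q) \<in> params N"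
    using \<theta> q by (auto simp: params_def)
  have nn: "0 \<le> f \<theta> i" if "i \<in> S" for i
    using that sub \<theta> by (auto simp: f_def params_def)
  have slot: "prod (f \<theta>) S \<le> c * prod (f (\<theta>(k := q))) S"
  proof (cases "k \<in> S")
    case True
    have eq: "prod (f (\<theta>(k := q))) (S - {k}) = prod (f \<theta>) (S - {k})"
      by (intro prod.cong) (auto simp: f_def)
    have "f \<theta> k * prod (f \<theta>) (S - {k}) \<le> c * f (\<theta>(k := q)) k * prod (f \<theta>) (S - {k})"
      using nn le True by (intro mult_right_mono prod_nonneg) (auto simp: f_def c_def)
    then show ?thesis
      using prod.remove[OF fin True, of "f \<theta>"] prod.remove[OF fin True, of "f (\<theta>(k := q))"]
      by (simp add: eq mult.assoc)
  next
    case False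
    then have "prod (f (\<theta>(k := q))) S = prod (f \<theta>) S"
      by (intro prod.cong) (auto simp: f_def)
    then show ?thesis
      using False by (simp add: c_def)
  qed
  have "likelihood \<theta> (history_after \<Gamma> z (Suc T)) = ?L \<theta> * prod (f \<theta>) S"
    by (simp only: likelihood_Suc f_def[abs_def] S_def)
  also have "\<dots> \<le> (a ^ ?X * b ^ (?Y - ?X) * ?L (\<theta>(k := q))) * (c * prod (f (\<theta>(k := q))) S)"
    using nn ab likelihood_nonneg[OF \<theta>'] by (intro mult_mono Suc.IH slot prod_nonneg) auto
  also have "\<dots> = (a ^ ?X * b ^ (?Y - ?X) * c) * (?L (\<theta>(k := q)) * prod (f (\<theta>(k := q))) S)"
    by (simp add: ac_simps)
  also have "?L (\<theta>(k := q)) * prod (f (\<theta>(k := q))) S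
      = likelihood (\<theta>(k := q)) (history_after \<Gamma> z (Suc T))"
    by (simp only: likelihood_Suc f_def[abs_def] S_def)
  \<comment> \<open>Truncated subtraction is harmless because \<open>?X \<le> ?Y\<close>: a busy
    observation raises the difference by exactly one.\<close>
  also have "a ^ ?X * b ^ (?Y - ?X) * c = a ^ sensed_free_count (history_after \<Gamma> z (Suc T)) k *
      b ^ (sensed_count (history_after \<Gamma> z (Suc T)) k - sensed_free_count (history_after \<Gamma> z (Suc T)) k)"
    using sensed_free_count_le[of \<Gamma> z T k]
    by (auto simp: sensed_count_Suc sensed_free_count_Suc c_def S_def Suc_diff_le
        simp del: history_after.simps)
  finally show ?case .
qed

section \<open>Histories as events of the product space\<close>

lemma channel_space_cylinder:
  fixes \<theta> :: "nat \<Rightarrow> real"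
  assumes \<theta>: "\<theta> \<in> params N"
  shows channel_space_cylinder_sets:
      "{z \<in> space (channel_space N \<theta>). history_after \<Gamma> z T = history_after \<Gamma> w T}
        \<in> sets (channel_space N \<theta>)" (is "?C \<in> _")
    and prob_history_eq:
      "measure (channel_space N \<theta>)
        {z \<in> space (channel_space N \<theta>). history_after \<Gamma> z T = history_after \<Gamma> w T}
        = likelihood \<theta> (history_after \<Gamma> w T)"
proof -
  let ?I = "{1..N} \<times> {1::nat..}"
  define K :: "nat \<times> nat \<Rightarrow> bool measure"
    where "K = (\<lambda>(i, j). measure_pmf (bernoulli_pmf (\<theta> i)))"
  have space_eq: "channel_space N \<theta> = PiM ?I K"
    by (simp add: channel_space_def K_def)
  interpret product_prob_space K ?I
    by (intro product_prob_spaceI) (auto simp: K_def split: prod.split intro: prob_space_measure_pmf)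
  \<comment> \<open>Coordinates are (channel, slot), but the sensed set depends on the slot.
    Building \<open>J\<close> from a dependent sum over slots lets the product over \<open>J\<close>
    split slot by slot.\<close>
  define J where "J = prod.swap ` (SIGMA j:{1..T}. sensed \<Gamma> w j)"
  have J: "J \<subseteq> ?I" "finite J"
    using sensed_subset finite_sensed by (fastforce simp: J_def)+
  have K: "space (K p) = UNIV" "sets (K p) = UNIV" for p
    by (auto simp: K_def split: prod.split)
  have C: "?C = prod_emb ?I K J (Pi\<^sub>E J (\<lambda>p. {w p}))"
  proof -
    have "(\<forall>p\<in>J. z p = w p) \<longleftrightarrow> history_after \<Gamma> z T = history_after \<Gamma> w T" for z
      by (force simp: history_after_eq_iff J_def)
    then have "?C = {z \<in> space (PiM ?I K). \<forall>p\<in>J. z p = w p}"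
      by (simp only: space_eq)
    also have "\<dots> = prod_emb ?I K J (Pi\<^sub>E J (\<lambda>p. {w p}))"
      by (auto simp: prod_emb_def space_PiM restrict_PiE_iff)
    finally show ?thesis .
  qed
  show "?C \<in> sets (channel_space N \<theta>)"
    unfolding C unfolding space_eq by (intro sets_PiM_I) (use J K in auto)
  have "measure (channel_space N \<theta>) ?C = (\<Prod>p\<in>J. measure (K p) {w p})"
    unfolding C unfolding space_eq by (intro measure_PiM_emb) (use J K in auto)
  also have "\<dots> = (\<Prod>(j, i)\<in>(SIGMA j:{1..T}. sensed \<Gamma> w j). measure (K (i, j)) {w (i, j)})"
    unfolding J_def by (subst prod.reindex) (auto intro!: prod.cong)
  also have "\<dots> = (\<Prod>j=1..T. \<Prod>i\<in>sensed \<Gamma> w j. measure (K (i, j)) {w (i, j)})"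
    using finite_sensed by (subst prod.Sigma) auto
  also have "\<dots> = (\<Prod>j=1..T. \<Prod>i\<in>sensed \<Gamma> w j. if w (i, j) then \<theta> i else 1 - \<theta> i)"
  proof (intro prod.cong refl)
    fix i j assume "i \<in> sensed \<Gamma> w j"
    then have "0 \<le> \<theta> i" "\<theta> i \<le> 1"
      using \<theta> sensed_subset by (auto simp: params_def)
    then show "measure (K (i, j)) {w (i, j)} = (if w (i, j) then \<theta> i else 1 - \<theta> i)"
      by (cases "w (i, j)") (auto simp: K_def measure_pmf_single)
  qed
  finally show "measure (channel_space N \<theta>) ?C = likelihood \<theta> (history_after \<Gamma> w T)"
    by (simp only: likelihood_eq_prod)
qed

lemma prob_space_channel_space: "prob_space (channel_space N \<theta>)"
  unfolding channel_space_def
  by (intro prob_space_PiM) (auto split: prod.split intro: prob_space_measure_pmf)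

lemma measurable_history_after:
  fixes \<theta> :: "nat \<Rightarrow> real"
  assumes \<theta>: "\<theta> \<in> params N"
  shows "(\<lambda>z. history_after \<Gamma> z T) \<in> channel_space N \<theta> \<rightarrow>\<^sub>M count_space UNIV"
proof -
  have "(\<lambda>z. history_after \<Gamma> z T) \<in> channel_space N \<theta> \<rightarrow>\<^sub>M count_space (range (\<lambda>z. history_after \<Gamma> z T))"
    using channel_space_cylinder_sets[OF \<theta>]
    by (subst measurable_count_space_eq2[OF finite_histories]) (auto simp: vimage_def Int_def conj_commute)
  then show ?thesis
    by (rule measurable_compose) simp
qed

lemma measurable_history_fun:
  fixes \<theta> :: "nat \<Rightarrow> real"
  assumes "\<theta> \<in> params N"
  shows "(\<lambda>z. f (history_after \<Gamma> z T)) \<in> borel_measurable (channel_space N \<theta>)"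
  using measurable_history_after[OF assms] by (rule measurable_compose) simp

lemma sets_history_pred:
  fixes \<theta> :: "nat \<Rightarrow> real"
  assumes "\<theta> \<in> params N"
  shows "{z \<in> space (channel_space N \<theta>). Q (history_after \<Gamma> z T)} \<in> sets (channel_space N \<theta>)"
  using measurable_sets[OF measurable_history_after[OF assms], of "Collect Q"]
  by (simp add: vimage_def Int_def conj_commute)

text \<open>The set of possible histories does not depend on \<theta>, only the weights do; two
  parameter vectors can therefore be compared term by term.\<close>

lemma prob_history_pred:
  fixes \<theta> :: "nat \<Rightarrow> real"
  assumes \<theta>: "\<theta> \<in> params N"
  shows "measure (channel_space N \<theta>) {z \<in> space (channel_space N \<theta>). Q (history_after \<Gamma> z T)}
    = (\<Sum>h\<in>{h \<in> range (\<lambda>z. history_after \<Gamma> z T). Q h}. likelihood \<theta> h)"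
proof -
  interpret prob_space "channel_space N \<theta>"
    by (rule prob_space_channel_space)
  let ?H = "{h \<in> range (\<lambda>z. history_after \<Gamma> z T). Q h}"
  let ?C = "\<lambda>h. {z \<in> space (channel_space N \<theta>). history_after \<Gamma> z T = h}"
  have "{z \<in> space (channel_space N \<theta>). Q (history_after \<Gamma> z T)} = (\<Union>h\<in>?H. ?C h)"
    by auto
  also have "prob \<dots> = (\<Sum>h\<in>?H. prob (?C h))"
    using finite_histories channel_space_cylinder_sets[OF \<theta>]
    by (intro finite_measure_finite_Union) (auto simp: disjoint_family_on_def)
  also have "\<dots> = (\<Sum>h\<in>?H. likelihood \<theta> h)"
    using prob_history_eq[OF \<theta>] by (intro sum.cong) auto
  finally show ?thesis .
qed

section \<open>Change of measure in one channel\<close>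

lemma prob_change_channel:
  fixes \<theta> :: "nat \<Rightarrow> real"
  assumes \<theta>: "\<theta> \<in> params N" and q: "0 \<le> q" "q \<le> 1" and ab: "0 \<le> a" "0 \<le> b" and C: "0 \<le> C"
    and le: "\<theta> k \<le> a * q" "1 - \<theta> k \<le> b * (1 - q)"
    and Q: "\<And>z. Q (history_after \<Gamma> z T) \<Longrightarrow>
      a ^ sensed_free_count (history_after \<Gamma> z T) k *
      b ^ (sensed_count (history_after \<Gamma> z T) k - sensed_free_count (history_after \<Gamma> z T) k) \<le> C"
  shows "measure (channel_space N \<theta>) {z \<in> space (channel_space N \<theta>). Q (history_after \<Gamma> z T)} \<le>
    C * measure (channel_space N (\<theta>(k := q)))
      {z \<in> space (channel_space N (\<theta>(k := q))). Q (history_after \<Gamma> z T)}"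
proof -
  have \<theta>': "\<theta>(k := q) \<in> params N"
    using \<theta> q by (auto simp: params_def)
  have "likelihood \<theta> h \<le> C * likelihood (\<theta>(k := q)) h"
    if h: "h \<in> range (\<lambda>z. history_after \<Gamma> z T)" "Q h" for h
  proof -
    obtain z where z: "h = history_after \<Gamma> z T"
      using h by auto
    show ?thesis
      unfolding z using Q[of z] h(2) z
      by (intro order.trans[OF likelihood_change_channel[OF \<theta> q ab le]] mult_right_mono
          likelihood_nonneg[OF \<theta>']) auto
  qed
  then show ?thesis
    unfolding prob_history_pred[OF \<theta>] prob_history_pred[OF \<theta>'] sum_distrib_left
    by (intro sum_mono) auto
qed

text \<open>
  The exponential moment of a Chernoff bound equals a likelihood ratio: tilting the parameter of
  channel \<open>i\<close> turns the exponentially weighted measure into a multiple of another channel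
  measure, so the adaptivity of the samples needs no martingale argument.
\<close>

lemma prob_tilt_le:
  fixes \<theta> :: "nat \<Rightarrow> real" and l c :: real and s :: nat
  assumes \<theta>: "\<theta> \<in> params N" and i: "i \<in> {1..N}"
  shows "measure (channel_space N \<theta>) {z \<in> space (channel_space N \<theta>).
      sensed_count (history_after \<Gamma> z T) i = s \<and>
      c \<le> l * (sensed_free_count (history_after \<Gamma> z T) i - \<theta> i * s)}
    \<le> exp (l\<^sup>2 * s / 8 - c)" (is "?lhs \<le> _")
proof -
  define p :: real where "p = \<theta> i"
  have p: "0 \<le> p" "p \<le> 1"
    using \<theta> i by (auto simp: params_def p_def)
  \<comment> \<open>\<open>m\<close> is the moment generating function at \<open>l\<close> of the
    centred Bernoulli variable, and \<open>q\<close> below is the success probability of the tilted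
    one.\<close>
  define m :: real where "m = p * exp (l * (1 - p)) + (1 - p) * exp (- l * p)"
  have m: "0 < m"
    unfolding m_def using p by (cases "p = 0") (auto intro: add_pos_nonneg)
  define q where "q = p * exp (l * (1 - p)) / m"
  have q': "1 - q = (1 - p) * exp (- l * p) / m"
  proof -
    have "1 - q = (m - p * exp (l * (1 - p))) / m"
      using m by (simp add: q_def diff_divide_distrib)
    also have "m - p * exp (l * (1 - p)) = (1 - p) * exp (- l * p)"
      unfolding m_def by (rule add_diff_cancel_left')
    finally show ?thesis .
  qed
  have "0 \<le> q" "0 \<le> 1 - q"
    unfolding q' unfolding q_def using p m by (auto intro!: divide_nonneg_pos mult_nonneg_nonneg)
  then have q: "0 \<le> q" "q \<le> 1"
    by simp_all
  \<comment> \<open>For \<open>0 < p < 1\<close> these are the ratios \<open>p / q\<close> and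
    \<open>(1 - p) / (1 - q)\<close>; in this form they remain meaningful at \<open>p = 0\<close>
    and \<open>p = 1\<close>.\<close>
  let ?a = "m * exp (- l * (1 - p))" and ?b = "m * exp (l * p)"
  have "?lhs \<le> (m ^ s * exp (- c)) * measure (channel_space N (\<theta>(i := q)))
      {z \<in> space (channel_space N (\<theta>(i := q))). sensed_count (history_after \<Gamma> z T) i = s \<and>
      c \<le> l * (sensed_free_count (history_after \<Gamma> z T) i - \<theta> i * s)}"
  proof (rule prob_change_channel[where a="?a" and b="?b", OF \<theta> q])
    show "\<theta> i \<le> ?a * q" "1 - \<theta> i \<le> ?b * (1 - q)"
    proof -
      have "exp (- l * (1 - p)) * exp (l * (1 - p)) = 1" "exp (l * p) * exp (- l * p) = 1"
        by (simp_all flip: exp_add)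
      moreover have "?a * q = p * (exp (- l * (1 - p)) * exp (l * (1 - p)))"
        unfolding q_def using m by simp
      moreover have "?b * (1 - q) = (1 - p) * (exp (l * p) * exp (- l * p))"
        unfolding q' using m by simp
      ultimately show "\<theta> i \<le> ?a * q" "1 - \<theta> i \<le> ?b * (1 - q)"
        by (simp_all add: p_def)
    qed
    fix z
    let ?X = "sensed_free_count (history_after \<Gamma> z T) i"
    assume "sensed_count (history_after \<Gamma> z T) i = s \<and> c \<le> l * (?X - \<theta> i * s)"
    then have s: "sensed_count (history_after \<Gamma> z T) i = s" and c: "c \<le> l * (?X - p * s)"
      by (auto simp: p_def)
    have X: "?X \<le> s"
      using sensed_free_count_le s by metis
    \<comment> \<open>With the count fixed to \<open>s\<close>, the ratio depends on the path only
      through \<open>?X - p * s\<close>, which is exactly what the event controls.\<close>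
    have "?a ^ ?X * ?b ^ (s - ?X) = m ^ s * exp (- l * (?X - p * s))"
    proof -
      have "exp (- l * (1 - p)) ^ ?X * exp (l * p) ^ (s - ?X) = exp (- l * (?X - p * s))"
        using X by (simp add: algebra_simps of_nat_diff flip: exp_of_nat_mult exp_add)
      moreover have "m ^ ?X * m ^ (s - ?X) = m ^ s"
        using X by (simp flip: power_add)
      moreover have "?a ^ ?X * ?b ^ (s - ?X) =
          (m ^ ?X * m ^ (s - ?X)) * (exp (- l * (1 - p)) ^ ?X * exp (l * p) ^ (s - ?X))"
        by (simp only: power_mult_distrib mult_ac)
      ultimately show ?thesis
        by (simp only:)
    qed
    also have "\<dots> \<le> m ^ s * exp (- c)"
      using c m by (intro mult_left_mono) auto
    finally show "?a ^ ?X * ?b ^ (sensed_count (history_after \<Gamma> z T) i - ?X) \<le> m ^ s * exp (- c)"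
      unfolding s .
  qed (use m in auto)
  also have "\<dots> \<le> (m ^ s * exp (- c)) * 1"
    using m prob_space.prob_le_1[OF prob_space_channel_space]
    by (intro mult_left_mono) auto
  also have "\<dots> \<le> exp (l\<^sup>2 / 8) ^ s * exp (- c)"
  proof -
    have "m \<le> exp (l\<^sup>2 / 8)"
      using bernoulli_mgf_le[OF p, of l] by (simp only: m_def)
    then show ?thesis
      using m by (auto intro!: power_mono)
  qed
  also have "\<dots> = exp (l\<^sup>2 * s / 8 - c)"
    unfolding exp_of_nat_mult[symmetric] exp_add[symmetric] by (simp add: mult.commute)
  finally show ?thesis .
qed

end

section \<open>The loss as an expectation\<close>

context channel_strategy
begin

lemma integrable_history_fun:
  fixes \<theta> :: "nat \<Rightarrow> real" and f :: "history \<Rightarrow> real"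
  assumes \<theta>: "\<theta> \<in> params N"
  shows "integrable (channel_space N \<theta>) (\<lambda>z. f (history_after \<Gamma> z T))"
proof -
  interpret prob_space "channel_space N \<theta>"
    by (rule prob_space_channel_space)
  let ?R = "(\<lambda>h. norm (f h)) ` range (\<lambda>z. history_after \<Gamma> z T)"
  have "norm (f (history_after \<Gamma> z T)) \<le> Max ?R" for z
    using finite_histories[of T] by (intro Max_ge) auto
  then show ?thesis
    by (intro integrable_const_bound[where B = "Max ?R"] measurable_history_fun \<theta>) auto
qed

lemma integrable_sensed_fun:
  fixes \<theta> :: "nat \<Rightarrow> real" and f :: "nat set \<Rightarrow> real"
  assumes "\<theta> \<in> params N"
  shows "integrable (channel_space N \<theta>) (\<lambda>z. f (sensed \<Gamma> z j))"
  unfolding sensed_def by (rule integrable_history_fun[OF assms])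

lemma integral_of_bool_history:
  fixes \<theta> :: "nat \<Rightarrow> real"
  assumes \<theta>: "\<theta> \<in> params N"
  shows "(\<integral>z. of_bool (Q (history_after \<Gamma> z T)) \<partial>channel_space N \<theta>)
    = measure (channel_space N \<theta>) {z \<in> space (channel_space N \<theta>). Q (history_after \<Gamma> z T)}"
    (is "_ = measure ?P ?A")
proof -
  have "(\<integral>z. of_bool (Q (history_after \<Gamma> z T)) \<partial>?P) = (\<integral>z. indicator ?A z \<partial>?P)"
    by (intro Bochner_Integration.integral_cong) (auto simp: indicator_def)
  also have "\<dots> = measure ?P ?A"
    by (simp add: Int_def cong: conj_cong)
  finally show ?thesis .
qed

lemma integral_sensed_count:
  fixes \<theta> :: "nat \<Rightarrow> real"
  assumes \<theta>: "\<theta> \<in> params N"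
  shows "(\<integral>z. sensed_count (history_after \<Gamma> z T) k \<partial>channel_space N \<theta>)
    = (\<Sum>j=1..T. \<integral>z. of_bool (k \<in> sensed \<Gamma> z j) \<partial>channel_space N \<theta>)"
  unfolding sensed_count_eq_sum of_nat_sum of_nat_of_bool
  by (intro Bochner_Integration.integral_sum integrable_sensed_fun[OF \<theta>])

text \<open>The probability of sensing a channel is the expectation of an indicator. In this form,
  bounds on the regret of a single set can be integrated.\<close>

lemma loss_eq_integral:
  fixes \<theta> :: "nat \<Rightarrow> real"
  assumes \<theta>: "\<theta> \<in> params N"
  shows "loss N M B \<theta> \<Gamma> T =
    B * (\<Sum>j=1..T. \<integral>z. slot_regret N M \<theta> (sensed \<Gamma> z j) \<partial>channel_space N \<theta>)"
proof -
  let ?P = "channel_space N \<theta>"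
  interpret prob_space ?P
    by (rule prob_space_channel_space)
  have 1: "(\<integral>z. slot_regret N M \<theta> (sensed \<Gamma> z j) \<partial>?P) =
      (\<Sum>i=1..M. ranked N \<theta> i) - (\<Sum>i=1..N. \<theta> i * measure ?P {z \<in> space ?P. i \<in> sensed \<Gamma> z j})" for j
  proof -
    have "(\<Sum>i\<in>sensed \<Gamma> z j. \<theta> i) = (\<Sum>i=1..N. \<theta> i * of_bool (i \<in> sensed \<Gamma> z j))" for z
      using sensed_subset[of z j] by (simp add: Int_absorb1 flip: sum.inter_restrict)
    then have "(\<integral>z. slot_regret N M \<theta> (sensed \<Gamma> z j) \<partial>?P) =
      (\<integral>z. (\<Sum>i=1..M. ranked N \<theta> i) - (\<Sum>i=1..N. \<theta> i * of_bool (i \<in> sensed \<Gamma> z j)) \<partial>?P)"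
      by (simp only: slot_regret_def)
    also have "\<dots> = (\<Sum>i=1..M. ranked N \<theta> i) - (\<Sum>i=1..N. \<integral>z. \<theta> i * of_bool (i \<in> sensed \<Gamma> z j) \<partial>?P)"
      using integrable_sensed_fun[OF \<theta>, of "\<lambda>S. \<theta> _ * of_bool (_ \<in> S)" j]
        integrable_sensed_fun[OF \<theta>, of "\<lambda>S. of_bool (_ \<in> S)" j]
      by (subst Bochner_Integration.integral_diff) (auto simp: prob_space Bochner_Integration.integral_sum simp del: sum_mult_of_bool_eq)
    also have "(\<lambda>i. \<integral>z. \<theta> i * of_bool (i \<in> sensed \<Gamma> z j) \<partial>?P) =
        (\<lambda>i. \<theta> i * measure ?P {z \<in> space ?P. i \<in> sensed \<Gamma> z j})"
    proof
      show "(\<integral>z. \<theta> i * of_bool (i \<in> sensed \<Gamma> z j) \<partial>?P) =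
        \<theta> i * measure ?P {z \<in> space ?P. i \<in> sensed \<Gamma> z j}" for i
        using integral_of_bool_history[OF \<theta>, of "\<lambda>h. i \<in> \<Gamma> h"] by (simp add: sensed_def)
    qed
    finally show ?thesis .
  qed
  show ?thesis
    unfolding 1 loss_def by (simp add: sum_subtractf sum_distrib_left right_diff_distrib mult_ac)
qed

lemma loss_nonneg:
  fixes \<theta> :: "nat \<Rightarrow> real"
  assumes "1 \<le> M" "M \<le> N" "0 \<le> B" "\<theta> \<in> params N"
  shows "0 \<le> loss N M B \<theta> \<Gamma> T"
  unfolding loss_eq_integral[OF assms(4)] using assms sensed_subset card_sensed
  by (intro mult_nonneg_nonneg sum_nonneg Bochner_Integration.integral_nonneg slot_regret_nonneg) auto

text \<open>Used with \<open>k \<in> S\<close>, where \<open>c\<close> is the gap of a bad channel,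
  and with \<open>k \<notin> S\<close>, where \<open>c\<close> is the price of missing a raised
  channel.\<close>

lemma loss_ge:
  fixes \<theta> :: "nat \<Rightarrow> real"
  assumes B: "0 \<le> B" and \<theta>: "\<theta> \<in> params N"
    and le: "\<And>S. S \<subseteq> {1..N} \<Longrightarrow> card S = M \<Longrightarrow> c * of_bool (Q S) \<le> slot_regret N M \<theta> S"
  shows "B * c * (\<Sum>j=1..T. \<integral>z. of_bool (Q (sensed \<Gamma> z j)) \<partial>channel_space N \<theta>)
    \<le> loss N M B \<theta> \<Gamma> T"
proof -
  let ?P = "channel_space N \<theta>"
  have "c * (\<integral>z. of_bool (Q (sensed \<Gamma> z j)) \<partial>?P) \<le> (\<integral>z. slot_regret N M \<theta> (sensed \<Gamma> z j) \<partial>?P)" for j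
    unfolding Bochner_Integration.integral_mult_right_zero[symmetric]
    using integrable_sensed_fun[OF \<theta>, of "\<lambda>S. c * of_bool (Q S)" j] integrable_sensed_fun[OF \<theta>]
    by (intro integral_mono le sensed_subset card_sensed)
  then show ?thesis
    unfolding loss_eq_integral[OF \<theta>] mult.assoc sum_distrib_left[of c]
    by (intro mult_left_mono sum_mono B)
qed

lemma loss_ge_sensed_count:
  fixes \<theta> :: "nat \<Rightarrow> real"
  assumes M: "1 \<le> M" "M \<le> N" and B: "0 \<le> B" and \<theta>: "\<theta> \<in> params N"
  shows "B * (ranked N \<theta> M - \<theta> k) * (\<integral>z. sensed_count (history_after \<Gamma> z T) k \<partial>channel_space N \<theta>)
    \<le> loss N M B \<theta> \<Gamma> T"
  unfolding integral_sensed_count[OF \<theta>] using slot_regret_ge[OF M]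
  by (intro loss_ge[OF B \<theta>]) auto

lemma loss_raised_channel_ge:
  fixes \<theta> :: "nat \<Rightarrow> real"
  assumes M: "1 \<le> M" "M \<le> N" and B: "0 \<le> B" and \<theta>': "\<theta>(k := q) \<in> params N" and k: "k \<in> {1..N}"
  shows "B * (q - ranked N \<theta> M) *
      (\<integral>z. real T - sensed_count (history_after \<Gamma> z T) k \<partial>channel_space N (\<theta>(k := q)))
    \<le> loss N M B (\<theta>(k := q)) \<Gamma> T"
proof -
  let ?P = "channel_space N (\<theta>(k := q))"
  have le: "(q - ranked N \<theta> M) * of_bool (k \<notin> S) \<le> slot_regret N M (\<theta>(k := q)) S"
    if "S \<subseteq> {1..N}" "card S = M" for S
    using slot_regret_nonneg[OF M that, of "\<theta>(k := q)"]
      slot_regret_raised_channel[OF M that, of k q \<theta>] k by auto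
  have "(\<integral>z. real T - sensed_count (history_after \<Gamma> z T) k \<partial>?P) =
      (\<Sum>j=1..T. \<integral>z. of_bool (k \<notin> sensed \<Gamma> z j) \<partial>?P)"
    unfolding sum_not_sensed[symmetric]
    by (intro Bochner_Integration.integral_sum integrable_sensed_fun[OF \<theta>'])
  then show ?thesis
    using loss_ge[OF B \<theta>', of "q - ranked N \<theta> M" "\<lambda>S. k \<notin> S"] le by simp
qed

text \<open>The swap in a slot need not be unique, so the indicators of all ordered pairs are
  summed: one of them is 1 whenever the regret is positive, and the regret never exceeds
  \<open>M\<close>.\<close>

lemma loss_le_swapped:
  fixes \<theta> :: "nat \<Rightarrow> real"
  assumes M: "1 \<le> M" "M \<le> N" and B: "0 \<le> B" and \<theta>: "\<theta> \<in> params N"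
  shows "loss N M B \<theta> \<Gamma> T \<le> B * M * (\<Sum>(i, k)\<in>{(i, k) \<in> {1..N} \<times> {1..N}. \<theta> i < \<theta> k}.
      \<integral>z. (\<Sum>j=1..T. of_bool (i \<in> sensed \<Gamma> z j \<and> k \<notin> sensed \<Gamma> z j) :: real) \<partial>channel_space N \<theta>)"
proof -
  let ?P = "channel_space N \<theta>"
  let ?D = "{(i, k) \<in> {1..N} \<times> {1..N}. \<theta> i < \<theta> k}"
  have fin: "finite ?D"
    by (rule finite_subset[of _ "{1..N} \<times> {1..N}"]) auto
  have le: "slot_regret N M \<theta> S \<le> real M * (\<Sum>(i, k)\<in>?D. of_bool (i \<in> S \<and> k \<notin> S) :: real)"
    if S: "S \<subseteq> {1..N}" "card S = M" for S
  proof (cases "0 < slot_regret N M \<theta> S")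
    case True
    obtain i k where ik: "i \<in> S" "k \<in> {1..N} - S" "\<theta> i < \<theta> k"
      using slot_regret_pos_swap[OF M S True] .
    then have "(\<lambda>(i, k). of_bool (i \<in> S \<and> k \<notin> S)) (i, k)
        \<le> (\<Sum>(i, k)\<in>?D. of_bool (i \<in> S \<and> k \<notin> S) :: real)"
      using fin S by (intro member_le_sum) auto
    then have "real M * 1 \<le> real M * (\<Sum>(i, k)\<in>?D. of_bool (i \<in> S \<and> k \<notin> S) :: real)"
      using ik by (intro mult_left_mono) auto
    with slot_regret_le[OF M S \<theta>] show ?thesis
      by simp
  next
    case False
    have "0 \<le> real M * (\<Sum>(i, k)\<in>?D. of_bool (i \<in> S \<and> k \<notin> S) :: real)"
      by (intro mult_nonneg_nonneg sum_nonneg) auto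
    with False show ?thesis
      by simp
  qed
  have int: "integrable ?P (\<lambda>z. of_bool (i \<in> sensed \<Gamma> z j \<and> k \<notin> sensed \<Gamma> z j) :: real)" for i j k
    using integrable_sensed_fun[OF \<theta>, of "\<lambda>S. of_bool (i \<in> S \<and> k \<notin> S)"] .
  have "(\<integral>z. slot_regret N M \<theta> (sensed \<Gamma> z j) \<partial>?P) \<le>
      real M * (\<Sum>(i, k)\<in>?D. \<integral>z. of_bool (i \<in> sensed \<Gamma> z j \<and> k \<notin> sensed \<Gamma> z j) \<partial>?P)" for j
  proof -
    have "(\<integral>z. slot_regret N M \<theta> (sensed \<Gamma> z j) \<partial>?P) \<le>
        (\<integral>z. real M * (\<Sum>(i, k)\<in>?D. of_bool (i \<in> sensed \<Gamma> z j \<and> k \<notin> sensed \<Gamma> z j)) \<partial>?P)"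
      by (intro integral_mono le sensed_subset card_sensed integrable_sensed_fun[OF \<theta>]
          integrable_sensed_fun[OF \<theta>, of "\<lambda>S. real M * (\<Sum>(i, k)\<in>?D. of_bool (i \<in> S \<and> k \<notin> S))" j])
    also have "\<dots> = real M * (\<Sum>(i, k)\<in>?D. \<integral>z. of_bool (i \<in> sensed \<Gamma> z j \<and> k \<notin> sensed \<Gamma> z j) \<partial>?P)"
      using int by (simp add: Bochner_Integration.integral_sum case_prod_unfold)
    finally show ?thesis .
  qed
  then have "loss N M B \<theta> \<Gamma> T \<le>
      B * (\<Sum>j=1..T. real M * (\<Sum>(i, k)\<in>?D. \<integral>z. of_bool (i \<in> sensed \<Gamma> z j \<and> k \<notin> sensed \<Gamma> z j) \<partial>?P))"
    unfolding loss_eq_integral[OF \<theta>] using B by (intro mult_left_mono sum_mono) auto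
  also have "\<dots> = B * M * (\<Sum>(i, k)\<in>?D. \<Sum>j=1..T. \<integral>z. of_bool (i \<in> sensed \<Gamma> z j \<and> k \<notin> sensed \<Gamma> z j) \<partial>?P)"
    unfolding sum_distrib_left[symmetric] case_prod_unfold by (subst sum.swap) simp
  also have "\<dots> = B * M * (\<Sum>(i, k)\<in>?D.
      \<integral>z. (\<Sum>j=1..T. of_bool (i \<in> sensed \<Gamma> z j \<and> k \<notin> sensed \<Gamma> z j)) \<partial>?P)"
    by (simp only: Bochner_Integration.integral_sum int)
  finally show ?thesis .
qed

lemma prob_deviation_le:
  fixes \<theta> :: "nat \<Rightarrow> real" and s :: nat and a :: real
  assumes \<theta>: "\<theta> \<in> params N" and i: "i \<in> {1..N}" and s: "0 < s" and a: "0 \<le> a"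
  shows "measure (channel_space N \<theta>) {z \<in> space (channel_space N \<theta>).
      sensed_count (history_after \<Gamma> z T) i = s \<and>
      a \<le> \<bar>sensed_free_count (history_after \<Gamma> z T) i - \<theta> i * s\<bar>}
    \<le> 2 * exp (- 2 * a\<^sup>2 / s)"
proof -
  let ?P = "channel_space N \<theta>"
  interpret prob_space ?P
    by (rule prob_space_channel_space)
  \<comment> \<open>\<open>l\<close> minimises \<open>l\<^sup>2 * s / 8 - l * a\<close>, and
    \<open>c = l * a\<close>.\<close>
  define l c where "l = 4 * a / s" and "c = 4 * a\<^sup>2 / s"
  let ?A = "\<lambda>l. {z \<in> space ?P. sensed_count (history_after \<Gamma> z T) i = s \<and>
      c \<le> l * (sensed_free_count (history_after \<Gamma> z T) i - \<theta> i * s)}"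
  have lc: "l\<^sup>2 * s / 8 - c = - 2 * a\<^sup>2 / s"
    using s by (simp add: l_def c_def field_simps power2_eq_square)
  have sets: "?A l \<in> sets ?P" "?A (- l) \<in> sets ?P"
    by (rule sets_history_pred[OF \<theta>])+
  have "c \<le> l * x \<or> c \<le> - l * x" if "a \<le> \<bar>x\<bar>" for x :: real
  proof -
    have "c = l * a"
      by (simp add: l_def c_def power2_eq_square)
    also have "\<dots> \<le> l * \<bar>x\<bar>"
      using that a s by (intro mult_left_mono) (auto simp: l_def)
    finally show ?thesis
      by (cases "0 \<le> x") auto
  qed
  then have "prob {z \<in> space ?P. sensed_count (history_after \<Gamma> z T) i = s \<and>
      a \<le> \<bar>sensed_free_count (history_after \<Gamma> z T) i - \<theta> i * s\<bar>} \<le> prob (?A l \<union> ?A (- l))"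
    by (intro finite_measure_mono sets.Un sets) blast
  also have "\<dots> \<le> prob (?A l) + prob (?A (- l))"
    by (intro measure_subadditive sets) auto
  also have "\<dots> \<le> exp (l\<^sup>2 * s / 8 - c) + exp ((- l)\<^sup>2 * s / 8 - c)"
    by (intro add_mono prob_tilt_le[OF \<theta> i])
  also have "\<dots> = 2 * exp (- 2 * a\<^sup>2 / s)"
    using lc by simp
  finally show ?thesis .
qed

end

section \<open>The single-index strategy\<close>

lemma sum_inverse_squares_le: "(\<Sum>j=1..T. 1 / (real j)\<^sup>2) \<le> 2"
proof -
  \<comment> \<open>The subtracted term strengthens the claim so that the induction step
    telescopes.\<close>
  have "(\<Sum>j=1..Suc T. 1 / (real j)\<^sup>2) \<le> 2 - 1 / real (Suc T)" for T
  proof (induction T)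
    case (Suc T)
    have "1 / (real (Suc (Suc T)))\<^sup>2 \<le> 1 / (real (Suc T) * real (Suc (Suc T)))"
      by (intro divide_left_mono) (auto simp: power2_eq_square)
    also have "\<dots> = 1 / real (Suc T) - 1 / real (Suc (Suc T))"
      by (simp add: field_simps)
    finally show ?case
      using Suc.IH by simp
  qed simp
  then have "(\<Sum>j=1..Suc T. 1 / (real j)\<^sup>2) \<le> 2" for T
    by (rule order.trans) simp
  then show ?thesis
    by (cases T) auto
qed

text \<open>At the last such slot the count is still at most \<open>u\<close>, and it already
  includes all earlier such slots; the extra 1 is the last slot itself.\<close>

lemma card_low_count_slots_le:
  assumes "0 \<le> u"
  shows "real (card {j \<in> {1..T}. i \<in> sensed \<Gamma> z j \<and>
      real (sensed_count (history_after \<Gamma> z (j - 1)) i) \<le> u}) \<le> u + 1" (is "real (card ?D) \<le> _")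
proof (cases "?D = {}")
  case False
  define j0 where "j0 = Max ?D"
  have j0: "j0 \<in> ?D"
    unfolding j0_def using False by (intro Max_in) auto
  have "?D \<subseteq> insert j0 {j \<in> {1..j0 - 1}. i \<in> sensed \<Gamma> z j}"
  proof
    fix j assume j: "j \<in> ?D"
    then have "j \<le> j0"
      unfolding j0_def by (intro Max_ge) auto
    with j show "j \<in> insert j0 {j \<in> {1..j0 - 1}. i \<in> sensed \<Gamma> z j}"
      by (cases "j = j0") auto
  qed
  then have "card ?D \<le> card (insert j0 {j \<in> {1..j0 - 1}. i \<in> sensed \<Gamma> z j})"
    by (intro card_mono) auto
  also have "\<dots> \<le> Suc (sensed_count (history_after \<Gamma> z (j0 - 1)) i)"
    unfolding sensed_count_eq_card by (simp add: card_insert_if)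
  finally show ?thesis
    using j0 by auto
next
  case True
  show ?thesis
    unfolding True using assms by simp
qed

locale single_index = channel_strategy +
  assumes M: "1 \<le> M" "M \<le> N" and index_strategy: "single_index_strategy N M \<Gamma>"
begin

abbreviation n_free :: "(nat \<times> nat \<Rightarrow> bool) \<Rightarrow> nat \<Rightarrow> nat \<Rightarrow> real" where
  "n_free z j i \<equiv> real (sensed_free_count (history_after \<Gamma> z (j - 1)) i)"

abbreviation n_sensed :: "(nat \<times> nat \<Rightarrow> bool) \<Rightarrow> nat \<Rightarrow> nat \<Rightarrow> real" where
  "n_sensed z j i \<equiv> real (sensed_count (history_after \<Gamma> z (j - 1)) i)"

lemma index_eq:
  assumes "1 \<le> j"
  shows "index (history_after \<Gamma> z (j - 1)) i =
    n_free z j i / n_sensed z j i + sqrt (2 * ln (real j) / n_sensed z j i)"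
  using assms by (simp add: index_def of_nat_diff)

lemma index_mono_sensed:
  assumes "init_slots N M < j" "i \<in> sensed \<Gamma> z j" "k \<in> {1..N}" "k \<notin> sensed \<Gamma> z j"
  shows "index (history_after \<Gamma> z (j - 1)) k \<le> index (history_after \<Gamma> z (j - 1)) i"
  using index_strategy assms by (auto simp: single_index_strategy_def)

lemma n_sensed_pos:
  assumes "init_slots N M < j" "i \<in> {1..N}"
  shows "1 \<le> n_sensed z j i"
proof -
  have "i \<in> (\<Union>t\<in>{1..init_slots N M}. sensed \<Gamma> z t)"
    using index_strategy assms by (auto simp: single_index_strategy_def)
  then obtain t where "t \<in> {1..init_slots N M}" "i \<in> sensed \<Gamma> z t"
    by blast
  then have "t \<in> {t \<in> {1..j - 1}. i \<in> sensed \<Gamma> z t}"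
    using assms by auto
  then have "sensed_count (history_after \<Gamma> z (j - 1)) i \<noteq> 0"
    unfolding sensed_count_eq_card by (subst card_0_eq) auto
  then show ?thesis
    by simp
qed

text \<open>
  The padding term alone forces exploration on every sample path: while channel \<open>k\<close> has been sensed
  fewer than \<open>ln T / 4\<close> times, its index is at least 2, and only channels sensed at most \<open>2 ln T\<close>
  times can compete.
\<close>

lemma low_count_of_neglected_channel:
  assumes j: "init_slots N M < j" "sqrt T \<le> j" "j \<le> T" and k: "k \<in> {1..N}" "k \<notin> sensed \<Gamma> z j"
    and low: "n_sensed z j k < ln T / 4" and i: "i \<in> sensed \<Gamma> z j"
  shows "n_sensed z j i \<le> 2 * ln T"
proof -
  have j1: "1 \<le> j"
    using j by simp
  have lnj: "0 \<le> ln j" "ln j \<le> ln T" "ln T \<le> 2 * ln j"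
  proof -
    show "0 \<le> ln j" "ln j \<le> ln T"
      using j j1 by auto
    \<comment> \<open>Padding terms contain \<open>ln j\<close>. From slot \<open>sqrt T\<close> on,
      passing to \<open>ln T\<close> costs at most a factor 2, so \<open>ln T / 4\<close> is at most
      \<open>ln j / 2\<close>, which gives \<open>k\<close> a padding of at least 2.\<close>
    have "ln (sqrt T) \<le> ln j"
      using j j1 by (subst ln_le_cancel_iff) auto
    then show "ln T \<le> 2 * ln j"
      using j j1 by (simp add: ln_sqrt)
  qed
  have i': "i \<in> {1..N}"
    using i sensed_subset by blast
  have Yk: "1 \<le> n_sensed z j k" and Yi: "1 \<le> n_sensed z j i"
    using n_sensed_pos j k i' by blast+
  have "4 \<le> 2 * ln j / n_sensed z j k"
    using low lnj Yk by (simp add: field_simps)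
  then have "2 \<le> sqrt (2 * ln j / n_sensed z j k)"
    by (intro real_le_rsqrt) simp
  moreover have "0 \<le> n_free z j k / n_sensed z j k"
    by simp
  ultimately have "2 \<le> index (history_after \<Gamma> z (j - 1)) k"
    unfolding index_eq[OF j1] by linarith
  also have "\<dots> \<le> index (history_after \<Gamma> z (j - 1)) i"
    using index_mono_sensed j i k by blast
  also have "\<dots> \<le> 1 + sqrt (2 * ln j / n_sensed z j i)"
  proof -
    have "n_free z j i / n_sensed z j i \<le> 1"
      using sensed_free_count_le[of \<Gamma> z "j - 1" i] Yi by (simp add: divide_le_eq_1)
    then show ?thesis
      unfolding index_eq[OF j1] by simp
  qed
  finally have "1 \<le> 2 * ln j / n_sensed z j i"
    by simp
  then show ?thesis
    using Yi lnj by (simp add: field_simps)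
qed

text \<open>If \<open>k\<close> stayed below the threshold, every late slot would sense either
  \<open>k\<close> or a channel with count at most \<open>2 * ln T\<close>. There are only
  \<open>O(ln T)\<close> slots of these two kinds, too few for the late slots. Uniformity in
  \<open>z\<close> allows the bound to be integrated.\<close>

lemma eventually_sensed_count_ge:
  "eventually (\<lambda>T. \<forall>z. \<forall>k\<in>{1..N}. ln (real T) / 4 \<le> sensed_count (history_after \<Gamma> z T) k) sequentially"
proof -
  define n0 where "n0 = init_slots N M"
  have "eventually (\<lambda>T. ln T / 4 + real N * (2 * ln T + 1) < real T - real n0 - sqrt T - 1) sequentially"
    using M by real_asymp
  moreover have "eventually (\<lambda>T. 1 \<le> T) sequentially"
    by (rule eventually_ge_at_top)
  ultimately show ?thesis
  proof eventually_elim
    case (elim T)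
    show ?case
    proof (intro allI ballI leI notI)
      fix z k assume k: "k \<in> {1..N}" and low: "sensed_count (history_after \<Gamma> z T) k < ln T / 4"
      have lnT: "0 \<le> ln T"
        using elim by simp
      let ?D = "\<lambda>i. {j \<in> {1..T}. i \<in> sensed \<Gamma> z j \<and>
        real (sensed_count (history_after \<Gamma> z (j - 1)) i) \<le> 2 * ln T}"
      let ?K = "{j \<in> {1..T}. k \<in> sensed \<Gamma> z j}"
      \<comment> \<open>Late slots lie beyond the initialization, so that all counts are positive,
        and beyond \<open>sqrt T\<close>.\<close>
      define n1 where "n1 = n0 + nat \<lceil>sqrt T\<rceil>"
      have n1: "real n1 \<le> n0 + sqrt T + 1" "sqrt T \<le> n1"
      proof -
        have "real (nat \<lceil>sqrt T\<rceil>) = of_int \<lceil>sqrt T\<rceil>"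
          by simp
        then show "real n1 \<le> n0 + sqrt T + 1" "sqrt T \<le> n1"
          unfolding n1_def of_nat_add by linarith+
      qed
      have "{n1 + 1..T} \<subseteq> ?K \<union> (\<Union>i\<in>{1..N}. ?D i)"
      proof
        fix j assume j: "j \<in> {n1 + 1..T}"
        show "j \<in> ?K \<union> (\<Union>i\<in>{1..N}. ?D i)"
        proof (cases "k \<in> sensed \<Gamma> z j")
          case False
          obtain i where i: "i \<in> sensed \<Gamma> z j"
            using card_sensed[of z j] M by fastforce
          have "n_sensed z j k \<le> sensed_count (history_after \<Gamma> z T) k"
            using sensed_count_mono[of "j - 1" T \<Gamma> z k] j by auto
          then have "n_sensed z j i \<le> 2 * ln T"
            using j n1 k False i low
            by (intro low_count_of_neglected_channel[of j T k]) (auto simp: n1_def n0_def)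
          with i j sensed_subset show ?thesis
            by auto
        qed (use j in auto)
      qed
      then have "card {n1 + 1..T} \<le> card ?K + card (\<Union>i\<in>{1..N}. ?D i)"
        by (intro order.trans[OF card_mono card_Un_le]) auto
      also have "card (\<Union>i\<in>{1..N}. ?D i) \<le> (\<Sum>i=1..N. card (?D i))"
        by (rule card_UN_le) simp
      finally have "real (T - n1) \<le> sensed_count (history_after \<Gamma> z T) k + (\<Sum>i=1..N. real (card (?D i)))"
        unfolding sensed_count_eq_card by (simp flip: of_nat_sum of_nat_add)
      also have "(\<Sum>i=1..N. real (card (?D i))) \<le> (\<Sum>i=1..N. 2 * ln T + 1)"
        using lnT by (intro sum_mono card_low_count_slots_le) auto
      also have "\<dots> = real N * (2 * ln T + 1)"
        by simp
      finally show False
        using elim low n1 by linarith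
    qed
  qed
qed

text \<open>For a sensed channel this says that the sample mean misses \<open>\<theta> i\<close> by
  at least the padding \<open>sqrt (2 * ln j / Y)\<close>, multiplied through by the count
  \<open>Y\<close>.\<close>

definition deviates :: "(nat \<Rightarrow> real) \<Rightarrow> nat \<Rightarrow> nat \<Rightarrow> history \<Rightarrow> bool" where
  "deviates \<theta> i j h \<longleftrightarrow> 0 < sensed_count h i \<and>
     sqrt (2 * real (sensed_count h i) * ln (real j))
       \<le> \<bar>real (sensed_free_count h i) - \<theta> i * real (sensed_count h i)\<bar>"

text \<open>The count is random, so a union bound runs over its values \<open>s\<close> from 1 to
  \<open>j - 1\<close>. The padding turns each term into
  \<open>2 * exp (- 4 * ln j)\<close>.\<close>

lemma prob_deviates_le:
  fixes \<theta> :: "nat \<Rightarrow> real"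
  assumes \<theta>: "\<theta> \<in> params N" and i: "i \<in> {1..N}" and j: "1 \<le> j"
  shows "measure (channel_space N \<theta>)
      {z \<in> space (channel_space N \<theta>). deviates \<theta> i j (history_after \<Gamma> z (j - 1))} \<le> 2 / (real j)\<^sup>2"
proof -
  let ?P = "channel_space N \<theta>"
  interpret prob_space ?P
    by (rule prob_space_channel_space)
  let ?A = "\<lambda>s. {z \<in> space ?P. sensed_count (history_after \<Gamma> z (j - 1)) i = s \<and>
      sqrt (2 * real s * ln (real j)) \<le> \<bar>sensed_free_count (history_after \<Gamma> z (j - 1)) i - \<theta> i * s\<bar>}"
  have sets: "?A s \<in> sets ?P" for s
    by (rule sets_history_pred[OF \<theta>])
  have "prob {z \<in> space ?P. deviates \<theta> i j (history_after \<Gamma> z (j - 1))} \<le> prob (\<Union>s\<in>{1..j - 1}. ?A s)"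
    using sensed_count_le[of \<Gamma> _ "j - 1" i] sets
    by (intro finite_measure_mono) (auto simp: deviates_def Suc_le_eq)
  also have "\<dots> \<le> (\<Sum>s=1..j - 1. prob (?A s))"
    using sets by (intro finite_measure_subadditive_finite) auto
  also have "\<dots> \<le> (\<Sum>s=1..j - 1. 2 / (real j) ^ 4)"
  proof (rule sum_mono)
    fix s assume s: "s \<in> {1..j - 1}"
    have "prob (?A s) \<le> 2 * exp (- 2 * (sqrt (2 * real s * ln (real j)))\<^sup>2 / s)"
      using s j by (intro prob_deviation_le[OF \<theta> i]) auto
    also have "- 2 * (sqrt (2 * real s * ln (real j)))\<^sup>2 / s = - (4 * ln j)"
      using s j by (simp add: field_simps)
    also have "2 * exp (- (4 * ln j)) = 2 / (real j) ^ 4"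
      using j exp_of_nat_mult[of 4 "ln (real j)"] by (simp add: exp_minus field_simps)
    finally show "prob (?A s) \<le> 2 / (real j) ^ 4" .
  qed
  also have "\<dots> = real (j - 1) * (2 / (real j) ^ 4)"
    by simp
  \<comment> \<open>A generous estimate of \<open>j - 1\<close>; the resulting exponent 2 is already
    summable.\<close>
  also have "\<dots> \<le> (real j)\<^sup>2 * (2 / (real j) ^ 4)"
  proof (rule mult_right_mono)
    have "real (j - 1) \<le> real j * 1"
      by simp
    also have "\<dots> \<le> real j * real j"
      using j by (intro mult_left_mono) auto
    finally show "real (j - 1) \<le> (real j)\<^sup>2"
      by (simp add: power2_eq_square)
  qed simp
  also have "\<dots> = 2 / (real j)\<^sup>2"
    using j by (simp add: field_simps flip: power_add)
  finally show ?thesis .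
qed

text \<open>Without deviations the index of \<open>k\<close> exceeds \<open>\<theta> k\<close>,
  while that of \<open>i\<close> is below \<open>\<theta> i\<close> plus twice its padding.
  Preferring \<open>i\<close> forces the gap to be at most twice the padding, which bounds the count
  of \<open>i\<close>.\<close>

lemma swap_imp_deviates_or_low_count:
  fixes \<theta> :: "nat \<Rightarrow> real"
  assumes j: "init_slots N M < j" "j \<le> T" and lt: "\<theta> i < \<theta> k"
    and i: "i \<in> sensed \<Gamma> z j" and k: "k \<in> {1..N}" "k \<notin> sensed \<Gamma> z j"
    and good: "\<not> deviates \<theta> i j (history_after \<Gamma> z (j - 1))" "\<not> deviates \<theta> k j (history_after \<Gamma> z (j - 1))"
  shows "n_sensed z j i \<le> 8 * ln T / (\<theta> k - \<theta> i)\<^sup>2"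
proof -
  have j1: "1 \<le> j"
    using j by simp
  have lnj: "0 \<le> ln j" "ln j \<le> ln T"
    using j j1 by auto
  have i': "i \<in> {1..N}"
    using i sensed_subset by blast
  have Yk: "1 \<le> n_sensed z j k" and Yi: "1 \<le> n_sensed z j i"
    using n_sensed_pos j k i' by blast+
  have dev: "\<bar>n_free z j c / n_sensed z j c - \<theta> c\<bar> < sqrt (2 * ln j / n_sensed z j c)"
    if "1 \<le> n_sensed z j c" "\<not> deviates \<theta> c j (history_after \<Gamma> z (j - 1))" for c
  proof -
    have "\<bar>n_free z j c - \<theta> c * n_sensed z j c\<bar> < sqrt (2 * n_sensed z j c * ln j)"
      using that by (auto simp: deviates_def)
    also have "sqrt (2 * n_sensed z j c * ln j) = sqrt ((n_sensed z j c)\<^sup>2 * (2 * ln j / n_sensed z j c))"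
      using that by (simp add: power2_eq_square)
    also have "\<dots> = n_sensed z j c * sqrt (2 * ln j / n_sensed z j c)"
      by (simp only: real_sqrt_mult real_sqrt_abs abs_of_nat)
    finally have "\<bar>n_free z j c - \<theta> c * n_sensed z j c\<bar> / n_sensed z j c < sqrt (2 * ln j / n_sensed z j c)"
      using that by (simp add: pos_divide_less_eq mult.commute)
    also have "\<bar>n_free z j c - \<theta> c * n_sensed z j c\<bar> / n_sensed z j c = \<bar>n_free z j c / n_sensed z j c - \<theta> c\<bar>"
    proof -
      have "n_free z j c / n_sensed z j c - \<theta> c = (n_free z j c - \<theta> c * n_sensed z j c) / n_sensed z j c"
        using that by (simp add: diff_divide_distrib)
      then show ?thesis
        by (simp only: abs_divide abs_of_nat)
    qed
    finally show ?thesis .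
  qed
  have "\<theta> k < index (history_after \<Gamma> z (j - 1)) k"
    unfolding index_eq[OF j1] using dev[OF Yk good(2)] by linarith
  also have "\<dots> \<le> index (history_after \<Gamma> z (j - 1)) i"
    using index_mono_sensed j i k by blast
  also have "\<dots> < \<theta> i + 2 * sqrt (2 * ln j / n_sensed z j i)"
    unfolding index_eq[OF j1] using dev[OF Yi good(1)] by linarith
  finally have "\<theta> k - \<theta> i \<le> 2 * sqrt (2 * ln j / n_sensed z j i)"
    by simp
  then have "(\<theta> k - \<theta> i)\<^sup>2 \<le> (2 * sqrt (2 * ln j / n_sensed z j i))\<^sup>2"
    using lt by (intro power_mono) auto
  also have "\<dots> = 8 * ln j / n_sensed z j i"
    using lnj by (simp add: power_mult_distrib)
  also have "\<dots> \<le> 8 * ln T / n_sensed z j i"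
    using lnj by (intro divide_right_mono) auto
  finally show ?thesis
    using Yi lt by (simp add: field_simps)
qed

text \<open>A swap falls into the initialization, a slot with low count of \<open>i\<close>, or a
  deviation of \<open>i\<close> or \<open>k\<close>. The 9 consists of the 1 from
  \<open>card_low_count_slots_le\<close> and 8 for the two channels, each contributing the sum of
  \<open>2 / j\<^sup>2\<close>, at most 4.\<close>

lemma expected_swaps_le:
  fixes \<theta> :: "nat \<Rightarrow> real"
  assumes \<theta>: "\<theta> \<in> params N" and ik: "i \<in> {1..N}" "k \<in> {1..N}" and lt: "\<theta> i < \<theta> k" and T: "1 \<le> T"
  shows "(\<integral>z. (\<Sum>j=1..T. of_bool (i \<in> sensed \<Gamma> z j \<and> k \<notin> sensed \<Gamma> z j)) \<partial>channel_space N \<theta>)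
    \<le> init_slots N M + 9 + 8 / (\<theta> k - \<theta> i)\<^sup>2 * ln T"
proof -
  let ?P = "channel_space N \<theta>"
  interpret prob_space ?P
    by (rule prob_space_channel_space)
  define u where "u = 8 * ln T / (\<theta> k - \<theta> i)\<^sup>2"
  have u: "0 \<le> u"
    using T by (simp add: u_def)
  let ?dev = "\<lambda>c j z. of_bool (deviates \<theta> c j (history_after \<Gamma> z (j - 1))) :: real"
  let ?n = "init_slots N M"
  have le: "(\<Sum>j=1..T. of_bool (i \<in> sensed \<Gamma> z j \<and> k \<notin> sensed \<Gamma> z j))
      \<le> real ?n + (u + 1) + (\<Sum>j=1..T. ?dev i j z + ?dev k j z)" for z
  proof -
    let ?low = "\<lambda>j. i \<in> sensed \<Gamma> z j \<and> n_sensed z j i \<le> u"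
    have "(\<Sum>j=1..T. of_bool (i \<in> sensed \<Gamma> z j \<and> k \<notin> sensed \<Gamma> z j))
        \<le> (\<Sum>j=1..T. of_bool (j \<le> ?n) + of_bool (?low j) + (?dev i j z + ?dev k j z))"
      using swap_imp_deviates_or_low_count[of _ T \<theta> i k z] lt ik
      by (intro sum_mono) (fastforce simp: u_def not_le)
    also have "\<dots> = (\<Sum>j=1..T. of_bool (j \<le> ?n)) + (\<Sum>j=1..T. of_bool (?low j)) + (\<Sum>j=1..T. ?dev i j z + ?dev k j z)"
      by (simp only: sum.distrib)
    also have "(\<Sum>j=1..T. of_bool (j \<le> ?n) :: real) \<le> ?n"
    proof -
      have "card {j \<in> {1..T}. j \<le> ?n} \<le> card {1..?n}"
        by (intro card_mono) auto
      then show ?thesis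
        by (simp add: Int_def)
    qed
    also have "(\<Sum>j=1..T. of_bool (?low j) :: real) \<le> u + 1"
      using card_low_count_slots_le[OF u, of T i \<Gamma> z] by (simp add: Int_def)
    finally show ?thesis
      by simp
  qed
  have int: "integrable ?P (?dev c j)" for c j
    by (rule integrable_history_fun[OF \<theta>])
  have "(\<integral>z. (\<Sum>j=1..T. of_bool (i \<in> sensed \<Gamma> z j \<and> k \<notin> sensed \<Gamma> z j)) \<partial>?P)
      \<le> (\<integral>z. real ?n + (u + 1) + (\<Sum>j=1..T. ?dev i j z + ?dev k j z) \<partial>?P)"
    by (intro integral_mono le Bochner_Integration.integrable_sum Bochner_Integration.integrable_add int
        integrable_sensed_fun[OF \<theta>, of "\<lambda>S. of_bool (i \<in> S \<and> k \<notin> S)"]) auto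
  also have "\<dots> = real ?n + (u + 1) + (\<Sum>j=1..T. (\<integral>z. ?dev i j z \<partial>?P) + (\<integral>z. ?dev k j z \<partial>?P))"
    using int by (simp add: Bochner_Integration.integral_add Bochner_Integration.integral_sum
        Bochner_Integration.integrable_sum prob_space)
  also have "(\<Sum>j=1..T. (\<integral>z. ?dev i j z \<partial>?P) + (\<integral>z. ?dev k j z \<partial>?P)) \<le> (\<Sum>j=1..T. 4 * (1 / (real j)\<^sup>2))"
  proof (rule sum_mono)
    fix j assume "j \<in> {1..T}"
    then have j: "1 \<le> j"
      by simp
    show "(\<integral>z. ?dev i j z \<partial>?P) + (\<integral>z. ?dev k j z \<partial>?P) \<le> 4 * (1 / (real j)\<^sup>2)"
      unfolding integral_of_bool_history[OF \<theta>]
      using prob_deviates_le[OF \<theta> ik(1) j] prob_deviates_le[OF \<theta> ik(2) j] by simp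
  qed
  also have "\<dots> \<le> 4 * 2"
    unfolding sum_distrib_left[symmetric] using sum_inverse_squares_le by (intro mult_left_mono) auto
  finally show ?thesis
    by (simp add: u_def)
qed

lemma loss_bigo_ln:
  fixes \<theta> :: "nat \<Rightarrow> real"
  assumes B: "0 \<le> B" and \<theta>: "\<theta> \<in> params N"
  shows "loss N M B \<theta> \<Gamma> \<in> O(\<lambda>T. ln (real T))"
proof -
  let ?D = "{(i, k) \<in> {1..N} \<times> {1..N}. \<theta> i < \<theta> k}"
  let ?b = "\<lambda>T (i, k). init_slots N M + 9 + 8 / (\<theta> k - \<theta> i)\<^sup>2 * ln (real T)"
  have "loss N M B \<theta> \<Gamma> T \<le> B * M * (\<Sum>p\<in>?D. ?b T p)" if "1 \<le> T" for T
    using B expected_swaps_le[OF \<theta> _ _ _ that]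
    by (intro order.trans[OF loss_le_swapped[OF M B \<theta>]] mult_left_mono sum_mono) auto
  then have "eventually (\<lambda>T. norm (loss N M B \<theta> \<Gamma> T) \<le> 1 * norm (B * M * (\<Sum>p\<in>?D. ?b T p))) sequentially"
    using loss_nonneg[OF M B \<theta>]
    by (intro eventually_mono[OF eventually_ge_at_top[of 1]]) (smt (verit) real_norm_def)
  then have "loss N M B \<theta> \<Gamma> \<in> O(\<lambda>T. B * M * (\<Sum>p\<in>?D. ?b T p))"
    by (rule bigoI)
  also have "(\<lambda>T. B * M * (\<Sum>p\<in>?D. ?b T p)) \<in> O(\<lambda>T. ln (real T))"
  proof -
    have "(\<lambda>T. c + d * ln (real T)) \<in> O(\<lambda>T. ln (real T))" for c d :: real
      by real_asymp
    from this[of "init_slots N M + 9" "8 / (\<theta> _ - \<theta> _)\<^sup>2"]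
    have "(\<lambda>T. \<Sum>p\<in>?D. ?b T p) \<in> O(\<lambda>T. ln (real T))"
      by (intro big_sum_in_bigo) auto
    then show ?thesis
      by (cases "B * M = 0") (auto simp: mult.assoc)
  qed
  finally show ?thesis .
qed

end

section \<open>Lower bound for consistent strategies\<close>

context channel_strategy
begin

text \<open>A Markov inequality: on this event \<open>k\<close> is missed in at least
  \<open>T / 2\<close> slots, and each miss costs at least
  \<open>B * (q - ranked N \<theta> M)\<close>.\<close>

lemma prob_rarely_sensed_le:
  fixes \<theta> :: "nat \<Rightarrow> real" and y :: real
  assumes M: "1 \<le> M" "M \<le> N" and B: "0 < B" and \<theta>': "\<theta>(k := q) \<in> params N" and k: "k \<in> {1..N}"
    and q: "ranked N \<theta> M < q" and y: "y \<le> T / 2" and T: "1 \<le> T"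
  shows "measure (channel_space N (\<theta>(k := q)))
      {z \<in> space (channel_space N (\<theta>(k := q))). sensed_count (history_after \<Gamma> z T) k < y}
    \<le> 2 / (B * (q - ranked N \<theta> M)) * (loss N M B (\<theta>(k := q)) \<Gamma> T / T)"
proof -
  let ?P = "channel_space N (\<theta>(k := q))" and ?d = "B * (q - ranked N \<theta> M)"
  let ?Y = "\<lambda>z. real (sensed_count (history_after \<Gamma> z T) k)"
  have d: "0 < ?d"
    using B q by simp
  have "T / 2 * measure ?P {z \<in> space ?P. ?Y z < y} = (\<integral>z. T / 2 * of_bool (?Y z < y) \<partial>?P)"
    using integral_of_bool_history[OF \<theta>', of "\<lambda>h. real (sensed_count h k) < y"] by simp
  also have "\<dots> \<le> (\<integral>z. real T - ?Y z \<partial>?P)"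
  proof (rule integral_mono)
    show "T / 2 * of_bool (?Y z < y) \<le> real T - ?Y z" for z
      using y sensed_count_le[of \<Gamma> z T k] by auto
    show "integrable ?P (\<lambda>z. real T / 2 * of_bool (?Y z < y))"
      by (rule integrable_history_fun[OF \<theta>'])
    show "integrable ?P (\<lambda>z. real T - ?Y z)"
      by (rule integrable_history_fun[OF \<theta>'])
  qed
  finally have "?d * (T / 2 * measure ?P {z \<in> space ?P. ?Y z < y}) \<le> ?d * (\<integral>z. real T - ?Y z \<partial>?P)"
    using d by (intro mult_left_mono) auto
  also have "\<dots> \<le> loss N M B (\<theta>(k := q)) \<Gamma> T"
    using B by (intro loss_raised_channel_ge[OF M _ \<theta>' k]) auto
  finally have "?d * T * measure ?P {z \<in> space ?P. ?Y z < y} \<le> 2 * loss N M B (\<theta>(k := q)) \<Gamma> T"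
    by simp
  then have "measure ?P {z \<in> space ?P. ?Y z < y} \<le> 2 * loss N M B (\<theta>(k := q)) \<Gamma> T / (?d * T)"
    using d T by (subst pos_le_divide_eq) (auto simp: mult.commute)
  then show ?thesis
    by simp
qed

text \<open>
  Change of measure: if channel \<open>k\<close> were rarely sensed, raising its parameter above the \<open>M\<close>-th best
  one would go unnoticed, with a linear loss at the raised parameter. On histories in which \<open>k\<close> is
  sensed fewer than \<open>c * ln T\<close> times the likelihood ratio is at most \<open>T powr (c * ln R)\<close>, and \<open>c\<close> is
  chosen so that this does not compensate the factor \<open>T powr (\<beta> - 1)\<close> from consistency.
\<close>

lemma consistent_loss_bigomega_ln:
  fixes \<theta> :: "nat \<Rightarrow> real"
  assumes M: "1 \<le> M" "M \<le> N" and B: "0 < B" and cons: "consistent N M B \<Gamma>" and \<theta>: "\<theta> \<in> params N"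
    and nd: "nondegenerate N M \<theta>" and lt1: "ranked N \<theta> M < 1"
  shows "loss N M B \<theta> \<Gamma> \<in> \<Omega>(\<lambda>T. ln (real T))"
proof -
  obtain k where k: "k \<in> {1..N}" "\<theta> k = ranked N \<theta> N"
    using ranked_last_attained[of N \<theta>] M by auto
  \<comment> \<open>Above the \<open>M\<close>-th best value, so that missing \<open>k\<close> is
    costly, and below 1, so that busy observations keep a finite likelihood ratio.\<close>
  define q where "q = (ranked N \<theta> M + 1) / 2"
  have gap: "\<theta> k < ranked N \<theta> M"
    using nd k by (simp add: nondegenerate_def)
  have nonneg: "0 \<le> \<theta> k"
    using \<theta> k(1) by (simp add: params_def)
  have q: "ranked N \<theta> M < q" "q < 1" "0 \<le> \<theta> k" "\<theta> k < q" "0 < q"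
    using lt1 gap nonneg by (auto simp: q_def)
  have \<theta>': "\<theta>(k := q) \<in> params N"
    using \<theta> q by (auto simp: params_def)
  \<comment> \<open>The ratio of a busy observation. A free one has ratio below 1, so
    \<open>R\<close> serves for both and the total ratio is at most \<open>R\<close> to the number
    of sensings.\<close>
  define R where "R = (1 - \<theta> k) / (1 - q)"
  have R: "1 < R" "1 - \<theta> k = R * (1 - q)"
    using q by (auto simp: R_def)
  obtain \<beta> where \<beta>: "\<beta> < 1" "loss N M B (\<theta>(k := q)) \<Gamma> \<in> O(\<lambda>T. real T powr \<beta>)"
    using cons \<theta>' unfolding consistent_def by blast
  obtain K where K: "0 < K" "eventually (\<lambda>T. norm (loss N M B (\<theta>(k := q)) \<Gamma> T) \<le> K * norm (real T powr \<beta>)) sequentially"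
    using \<beta>(2) by (elim landau_o.bigE)
  define \<gamma> where "\<gamma> = 1 - \<beta>"
  \<comment> \<open>Half of the exponent \<gamma> is spent on the likelihood ratio; the other half
    leaves the factor \<open>T powr (- \<gamma> / 2)\<close>, which tends to 0.\<close>
  define c where "c = \<gamma> / (2 * ln R)"
  have c: "0 < c" "c * ln R = \<gamma> / 2" and \<gamma>: "0 < \<gamma>"
    using \<beta> R by (auto simp: c_def \<gamma>_def)
  define K' where "K' = 2 * K / (B * (q - ranked N \<theta> M))"
  have K': "0 < K'"
    using K B q by (simp add: K'_def)
  define d where "d = B * (ranked N \<theta> M - \<theta> k)"
  have d: "0 < d"
    using B gap by (simp add: d_def)
  have "eventually (\<lambda>T. K' * real T powr (- \<gamma> / 2) \<le> 1 / 2) sequentially"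
    using \<gamma> K' by real_asymp
  moreover have "eventually (\<lambda>T. c * ln (real T) \<le> T / 2) sequentially"
    using c by real_asymp
  ultimately have "eventually (\<lambda>T. d * (c / 2) * norm (ln (real T)) \<le> norm (loss N M B \<theta> \<Gamma> T)) sequentially"
    using K(2) eventually_ge_at_top[of 1]
  proof eventually_elim
    case (elim T)
    let ?P = "channel_space N \<theta>" and ?P' = "channel_space N (\<theta>(k := q))"
    let ?Y = "\<lambda>z. real (sensed_count (history_after \<Gamma> z T) k)"
    define y where "y = c * ln T"
    have T: "0 < real T" "1 \<le> T"
      using elim by auto
    have y: "0 \<le> y" "y \<le> T / 2"
      using elim c by (auto simp: y_def)
    interpret prob_space ?P
      by (rule prob_space_channel_space)
    have "measure ?P {z \<in> space ?P. ?Y z < y}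
        \<le> T powr (\<gamma> / 2) * measure ?P' {z \<in> space ?P'. ?Y z < y}"
    proof (rule prob_change_channel[where a=R and b=R, OF \<theta>])
      have "\<theta> k \<le> 1 * q"
        using q by simp
      also have "\<dots> \<le> R * q"
        using R q by (intro mult_right_mono) auto
      finally show "\<theta> k \<le> R * q" .
      fix z assume Y: "?Y z < y"
      have "R ^ sensed_free_count (history_after \<Gamma> z T) k *
          R ^ (sensed_count (history_after \<Gamma> z T) k - sensed_free_count (history_after \<Gamma> z T) k)
          = R powr ?Y z"
        using sensed_free_count_le[of \<Gamma> z T k] R by (simp add: powr_realpow flip: power_add)
      also have "\<dots> \<le> R powr y"
        using R Y by (intro powr_mono) auto
      also have "\<dots> = T powr (c * ln R)"
        using R T by (simp add: powr_def y_def)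
      finally show "R ^ sensed_free_count (history_after \<Gamma> z T) k *
          R ^ (sensed_count (history_after \<Gamma> z T) k - sensed_free_count (history_after \<Gamma> z T) k)
          \<le> T powr (\<gamma> / 2)"
        using c by simp
    qed (use R q in auto)
    also have "\<dots> \<le> T powr (\<gamma> / 2) * (2 / (B * (q - ranked N \<theta> M)) * (loss N M B (\<theta>(k := q)) \<Gamma> T / T))"
      using T y by (intro mult_left_mono prob_rarely_sensed_le[OF M B \<theta>' k(1) q(1)]) auto
    also have "\<dots> \<le> T powr (\<gamma> / 2) * (2 / (B * (q - ranked N \<theta> M)) * (K * T powr \<beta> / T))"
      using elim T B q by (intro mult_left_mono divide_right_mono) auto
    also have "\<dots> = K' * (T powr (\<gamma> / 2) * T powr \<beta> / T powr 1)"
      using T by (simp add: K'_def)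
    also have "T powr (\<gamma> / 2) * T powr \<beta> / T powr 1 = T powr (- \<gamma> / 2)"
      unfolding powr_add[symmetric] powr_diff[symmetric] by (simp add: \<gamma>_def field_simps)
    finally have half: "measure ?P {z \<in> space ?P. ?Y z < y} \<le> 1 / 2"
      using elim by simp
    have int: "integrable ?P ?Y" "integrable ?P (\<lambda>z. y - y * of_bool (?Y z < y))"
      by (rule integrable_history_fun[OF \<theta>])+
    have int': "integrable ?P (\<lambda>z. of_bool (?Y z < y) :: real)"
      by (rule integrable_history_fun[OF \<theta>])
    \<comment> \<open>\<open>y\<close> times the indicator of \<open>y \<le> ?Y z\<close> lies below
      \<open>?Y z\<close>, and that event has probability at least 1/2.\<close>
    have "y / 2 \<le> y - y * measure ?P {z \<in> space ?P. ?Y z < y}"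
      using mult_left_mono[OF half y(1)] by simp
    also have "\<dots> = (\<integral>z. y - y * of_bool (?Y z < y) \<partial>?P)"
      using int' integral_of_bool_history[OF \<theta>, of "\<lambda>h. real (sensed_count h k) < y" T]
      by (simp add: prob_space)
    also have "\<dots> \<le> (\<integral>z. ?Y z \<partial>?P)"
      using int by (intro integral_mono) auto
    finally have "d * (y / 2) \<le> d * (\<integral>z. ?Y z \<partial>?P)"
      using d by (intro mult_left_mono) auto
    also have "\<dots> \<le> loss N M B \<theta> \<Gamma> T"
      unfolding d_def using B by (intro loss_ge_sensed_count[OF M _ \<theta>]) auto
    finally show ?case
      using T by (simp add: y_def mult.assoc)
  qed
  then show ?thesis
    using d c by (intro landau_omega.bigI[of "d * (c / 2)"]) auto
qed

end

section \<open>Exact order and consistency of the index strategy\<close>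

context single_index
begin

lemma loss_same_order_ln:
  fixes \<theta> :: "nat \<Rightarrow> real"
  assumes B: "0 < B" and \<theta>: "\<theta> \<in> params N" and nd: "nondegenerate N M \<theta>"
  shows "same_order (loss N M B \<theta> \<Gamma>) (\<lambda>T. ln (real T))"
proof -
  obtain k where k: "k \<in> {1..N}" "\<theta> k = ranked N \<theta> N"
    using ranked_last_attained[of N \<theta>] M by auto
  define d where "d = B * (ranked N \<theta> M - \<theta> k)"
  have d: "0 < d"
    using B nd k by (simp add: d_def nondegenerate_def)
  obtain K where K: "0 < K" "eventually (\<lambda>T. norm (loss N M B \<theta> \<Gamma> T) \<le> K * norm (ln (real T))) sequentially"
    using loss_bigo_ln[OF _ \<theta>, of B] B by (auto elim: landau_o.bigE)
  \<comment> \<open>The maximum secures the condition \<open>c1 \<le> c2\<close> of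
    \<open>same_order\<close>.\<close>
  have "eventually (\<lambda>T. d / 4 * ln (real T) \<le> loss N M B \<theta> \<Gamma> T \<and>
      loss N M B \<theta> \<Gamma> T \<le> max K (d / 4) * ln (real T)) sequentially"
    using eventually_sensed_count_ge K(2) eventually_ge_at_top[of 1]
  proof eventually_elim
    case (elim T)
    let ?P = "channel_space N \<theta>"
    interpret prob_space ?P
      by (rule prob_space_channel_space)
    have "ln (real T) / 4 = (\<integral>z. ln (real T) / 4 \<partial>?P)"
      by (simp add: prob_space)
    also have "\<dots> \<le> (\<integral>z. sensed_count (history_after \<Gamma> z T) k \<partial>?P)"
      using elim(1) k by (intro integral_mono integrable_history_fun[OF \<theta>]) auto
    finally have "d * (ln (real T) / 4) \<le> d * (\<integral>z. sensed_count (history_after \<Gamma> z T) k \<partial>?P)"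
      using d by (intro mult_left_mono) auto
    also have "\<dots> \<le> loss N M B \<theta> \<Gamma> T"
      unfolding d_def using B by (intro loss_ge_sensed_count[OF M _ \<theta>]) auto
    finally have "d / 4 * ln (real T) \<le> loss N M B \<theta> \<Gamma> T"
      by simp
    moreover have "loss N M B \<theta> \<Gamma> T \<le> K * ln (real T)"
      using elim by simp
    moreover have "K * ln (real T) \<le> max K (d / 4) * ln (real T)"
      using elim by (intro mult_right_mono) auto
    ultimately show ?case
      by linarith
  qed
  then obtain T0 where "\<forall>T\<ge>T0. d / 4 * ln (real T) \<le> loss N M B \<theta> \<Gamma> T \<and>
      loss N M B \<theta> \<Gamma> T \<le> max K (d / 4) * ln (real T)"
    unfolding eventually_sequentially by blast
  then show ?thesis
    unfolding same_order_def using d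
    by (intro exI[of _ "d / 4"] exI[of _ "max K (d / 4)"] exI[of _ T0]) auto
qed

lemma consistent_single_index:
  assumes B: "0 < B"
  shows "consistent N M B \<Gamma>"
  unfolding consistent_def
proof (intro conjI ballI is_strategy)
  fix \<theta> assume "\<theta> \<in> params N"
  then have "loss N M B \<theta> \<Gamma> \<in> O(\<lambda>T. ln (real T))"
    using B by (intro loss_bigo_ln) auto
  \<comment> \<open>One exponent serves for all \<theta>; any value strictly between 0 and 1 would
    do.\<close>
  also have "(\<lambda>T. ln (real T)) \<in> O(\<lambda>T. real T powr (1 / 2))"
    by real_asymp
  finally show "\<exists>\<beta><1. loss N M B \<theta> \<Gamma> \<in> O(\<lambda>T. real T powr \<beta>)"
    by (intro exI[of _ "1 / 2"]) auto
qed

end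

theorem lemma11:
  fixes N M :: nat and B :: real and \<Gamma> :: strategy
  assumes "1 \<le> M" and "M \<le> N" and "0 < B"
    and "single_index_strategy N M \<Gamma>"
  shows "order_optimal N M B \<Gamma> \<and>
    (\<forall>\<theta>\<in>params N.
       loss N M B \<theta> \<Gamma> \<in> O(\<lambda>T. ln (real T)) \<and>
       (nondegenerate N M \<theta> \<longrightarrow> same_order (loss N M B \<theta> \<Gamma>) (\<lambda>T. ln (real T))))"
proof -
  interpret single_index N M \<Gamma>
    using assms by unfold_locales (auto simp: single_index_strategy_def)
  have "loss N M B \<theta> \<Gamma>' \<in> \<Omega>(\<lambda>T. ln (real T))"
    if "consistent N M B \<Gamma>'" "\<theta> \<in> params N" "nondegenerate N M \<theta> \<and> ranked N \<theta> M < 1" for \<Gamma>' \<theta>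
  proof -
    \<comment> \<open>A competitor need not follow an index rule, so only the change of measure is
      available for it, not the exploration forced by the padding.\<close>
    interpret \<Gamma>': channel_strategy N M \<Gamma>'
      using that by unfold_locales (auto simp: consistent_def)
    show ?thesis
      using \<Gamma>'.consistent_loss_bigomega_ln that M assms by blast
  qed
  then show ?thesis
    unfolding order_optimal_def
    using consistent_single_index loss_same_order_ln loss_bigo_ln assms by (simp add: less_imp_le)
qed

end
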